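(* Let $k>0$ be such that $k^2$ is not a Dirichlet eigenvalue of the Laplacian on the unit disc, and let $R>1$. (i) Let $\rho>1$ and let $v$ be analytic boundary data on the unit circle whose Fourier coefficients satisfy $|\hat v(m)|\sim C_0\,\rho^{-|m|}$ as $|m|\to\infty$ ($m\in\mathbb{Z}$), for some constant $C_0>0$. Then there is a constant $C>0$, which may depend on $k$, $R$ and $v$ but not on $N$, such that for every even positive integer $N$ the minimum boundary error $t_N:=\min_{\bm\alpha\in\mathbb{C}^N} t[\bm\alpha]$ achievable with the Method of Fundamental Solutions (with $N$ charge points equally spaced on the circle of radius $R$) satisfies $$ t_N \;\le\; \begin{cases} C\rho^{-N/2}, & \rho<R^2,\\ C\sqrt{N}\,R^{-N}, & \rho=R^2,\\ C R^{-N}, & \rho>R^2. \end{cases} $$ (ii) If $v$ is analytically continuable to an entire function, then for any $R>1$ there is a constant $C>0$, which may depend on $k$, $R$ and $v$ but not on $N$, such that $t_N\le C R^{-N}$ for every even positive integer $N$.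
   Context: Identify $\mathbb{R}^2$ with $\mathbb{C}$. $\Omega=\{x:|x|<1\}$ is the unit disc, with boundary $\partial\Omega$ the unit circle. For a function $v$ on $\partial\Omega$, its Fourier coefficients are $\hat v(m)=\frac{1}{2\pi}\int_0^{2\pi} v(e^{i\theta})e^{-im\theta}\,d\theta$, $m\in\mathbb{Z}$. "$a_m\sim b_m$ as $|m|\to\infty$" means $a_m/b_m\to1$. For a positive integer $N$, the charge points are $y_j=Re^{i\phi_j}$ with $\phi_j=2\pi j/N$, $j=1,\dots,N$. For a coefficient vector $\bm\alpha=(\alpha_1,\dots,\alpha_N)\in\mathbb{C}^N$, the Method of Fundamental Solutions (MFS) representation is $$u^{(N)}(x)=\frac{i}{4}\sum_{j=1}^N\alpha_j H_0^{(1)}(k|x-y_j|),$$ where $H_0^{(1)}$ is the Hankel function of the first kind of order zero. The boundary error is $t[\bm\alpha]=\|u^{(N)}-v\|_{L^2(\partial\Omega)}$. The condition that $k^2$ is not a Dirichlet eigenvalue of the unit disc means $J_m(k)\ne0$ for all $m\in\mathbb{Z}$, where $J_m$ is the Bessel function of the first kind. *)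

theory Defs
  imports "HOL-Analysis.Analysis" "HOL-Library.Landau_Symbols"
begin

(* Ascending series of the Bessel function of integer order. For m < 0 the terms with
   j < -m vanish because rGamma is zero at the poles of Gamma. *)
definition bessel_J :: "int \<Rightarrow> real \<Rightarrow> real" where
  "bessel_J m x =
     (\<Sum>j. (-1) ^ j / fact j * rGamma (of_int m + of_nat j + 1) * (x / 2) powi (m + 2 * int j))"

(* Ascending series of the Bessel function of the second kind, x > 0. The j = 0 term is zero. *)
definition bessel_Y0 :: "real \<Rightarrow> real" where
  "bessel_Y0 x = 2 / pi * ((ln (x / 2) + euler_mascheroni) * bessel_J 0 x
     + (\<Sum>j. (-1) ^ (j + 1) * harm j * (x\<^sup>2 / 4) ^ j / (fact j)\<^sup>2))"

definition hankel1_0 :: "real \<Rightarrow> complex" where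
  "hankel1_0 x = Complex (bessel_J 0 x) (bessel_Y0 x)"

definition fourier_coeff :: "(complex \<Rightarrow> complex) \<Rightarrow> int \<Rightarrow> complex" where
  "fourier_coeff v m =
     1 / (2 * of_real pi) * integral {0..2 * pi} (\<lambda>\<theta>. v (cis \<theta>) * cis (- (of_int m * \<theta>)))"

(* Arc length on the unit circle is the parameter theta. *)
definition L2_norm_circle :: "(complex \<Rightarrow> complex) \<Rightarrow> real" where
  "L2_norm_circle f = sqrt (integral {0..2 * pi} (\<lambda>\<theta>. (cmod (f (cis \<theta>)))\<^sup>2))"

definition charge_point :: "real \<Rightarrow> nat \<Rightarrow> nat \<Rightarrow> complex" where
  "charge_point R N j = of_real R * cis (2 * pi * real j / real N)"

(* A coefficient vector in C^N is a function on nat of which only the values at 1, ..., N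
   enter. *)
definition mfs :: "real \<Rightarrow> real \<Rightarrow> nat \<Rightarrow> (nat \<Rightarrow> complex) \<Rightarrow> complex \<Rightarrow> complex" where
  "mfs k R N \<alpha> x = \<i> / 4 * (\<Sum>j = 1..N. \<alpha> j * hankel1_0 (k * cmod (x - charge_point R N j)))"

definition boundary_error ::
  "real \<Rightarrow> real \<Rightarrow> (complex \<Rightarrow> complex) \<Rightarrow> nat \<Rightarrow> (nat \<Rightarrow> complex) \<Rightarrow> real" where
  "boundary_error k R v N \<alpha> = L2_norm_circle (\<lambda>x. mfs k R N \<alpha> x - v x)"

(* A genuine minimum, not an infimum: Least is unspecified unless the value is attained. *)
definition min_boundary_error :: "real \<Rightarrow> real \<Rightarrow> (complex \<Rightarrow> complex) \<Rightarrow> nat \<Rightarrow> real" where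
  "min_boundary_error k R v N = (LEAST t. t \<in> range (boundary_error k R v N))"

(* Only the values of v on the circle matter: real-analyticity there means that v is the
   restriction of a function holomorphic in a neighbourhood of the circle. *)
definition analytic_boundary_data :: "(complex \<Rightarrow> complex) \<Rightarrow> bool" where
  "analytic_boundary_data v \<longleftrightarrow>
     (\<exists>f. f analytic_on sphere 0 1 \<and> (\<forall>z\<in>sphere 0 1. f z = v z))"

definition entire_boundary_data :: "(complex \<Rightarrow> complex) \<Rightarrow> bool" where
  "entire_boundary_data v \<longleftrightarrow>
     (\<exists>f. f holomorphic_on UNIV \<and> (\<forall>z\<in>sphere 0 1. f z = v z))"

end

theory Submission
  imports Defs "HOL-Complex_Analysis.Complex_Analysis" "HOL-Library.Real_Mod"
begin

text \<open>
  Write \<open>s\<^sub>m\<close> for the Fourier coefficients on the unit circle of the field of a unit charge at the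
  point \<open>R\<close>; a charge at angle \<open>\<phi>\<close> then has the coefficients \<open>s\<^sub>m e\<^bsup>-im\<phi>\<^esup>\<close>. For \<open>N\<close> equally spaced
  charges the frequency \<open>m\<close> of the total field is \<open>s\<^sub>m\<close> times a discrete Fourier transform of the charge
  strengths, which depends only on the class of \<open>m\<close> modulo \<open>N\<close>. The strengths can therefore be chosen
  so that the data are reproduced exactly at one frequency \<open>r\<close> of every residue class, the one with
  \<open>-N/2 < r \<le> N/2\<close> (\<open>discrete_fourier_inversion\<close>). What is left of the error are the frequencies of
  the data at or beyond \<open>N/2\<close> and the aliases: the frequency \<open>r\<close> reappears at each \<open>m\<close> congruent to \<open>r\<close>
  modulo \<open>N\<close> with the factor \<open>s\<^sub>m/s\<^sub>r\<close>.

  The aliases are controlled by the fact that \<open>\<bar>s\<^sub>m\<bar>\<close> lies between two constant multiples of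
  \<open>R\<^bsup>-\<bar>m\<bar>\<^esup>/(\<bar>m\<bar>+1)\<close> (\<open>mfs_kernel_coeffs\<close>), so that such a factor is at most a constant times
  \<open>R\<^bsup>\<bar>r\<bar>-\<bar>m\<bar>\<^esup>\<close>. If the data decay like \<open>\<rho>\<^bsup>-\<bar>m\<bar>\<^esup>\<close>, Parseval's identity bounds the squared error by a
  multiple of \<open>\<rho>\<^bsup>-N\<^esup> + R\<^bsup>-2N\<^esup> \<Sum> (R\<^sup>2/\<rho>)\<^bsup>2\<bar>r\<bar>\<^esup>\<close>, the sum extending over \<open>\<bar>r\<bar> \<le> N/2\<close>
  (\<open>mfs_error_bound\<close>). The three rates are the three behaviours of this geometric sum. Data that extend
  to an entire function decay faster than any \<open>\<rho>\<^bsup>-\<bar>m\<bar>\<^esup>\<close>, hence fall under the last case.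

  The two-sided bound rests on the factorisation
  \<open>s\<^sub>m = const J\<^sub>m(k) H\<^sub>m(kR)\<close>, an instance of Graf's addition theorem. It is derived from the ascending
  series: the Hankel function of \<open>2\<bar>x\<bar>\<close> is a sum over \<open>j\<close> of products of a function of \<open>x\<close> and a
  function of the conjugate of \<open>x\<close>, each factor has an explicit Taylor expansion in \<open>e\<^bsup>i\<theta>\<^esup>\<close> or its
  conjugate, and the coefficient of \<open>e\<^bsup>im\<theta>\<^esup>\<close>, summed over \<open>j\<close>, is a Cauchy product
  (\<open>kernel_fourier\<close>). The series of the two factors give their behaviour for large \<open>m\<close>. For small
  \<open>m\<close> it must be known that no \<open>s\<^sub>m\<close> vanishes: \<open>J\<^sub>m(k)\<close> is nonzero by hypothesis, and \<open>H\<^sub>m(kR)\<close> is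
  nonzero because \<open>J\<close> and \<open>H\<close> satisfy the same three-term recurrence in \<open>m\<close>, so that
  \<open>H\<^sub>m\<^sub>+\<^sub>1 J\<^sub>m - H\<^sub>m J\<^sub>m\<^sub>+\<^sub>1\<close> does not depend on \<open>m\<close>, and its limit is not zero
  (\<open>hankel_coeff_nonzero\<close>).

  Finally, the minimal error is attained, because the best approximation in the span of finitely many
  functions is an orthogonal projection (\<open>least_squares_attained\<close>); the minimum is therefore a lower
  bound for the error of the particular charges above.
\<close>

section \<open>Fourier coefficients on the unit circle\<close>

lemma continuous_on_circle_param:
  "continuous_on (sphere 0 1) f \<Longrightarrow> continuous_on {0..2*pi} (\<lambda>t. f (cis t))"
  by (rule continuous_on_compose2[of "sphere 0 1" f]) (auto intro!: continuous_intros)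

lemma integrable_fourier:
  assumes "continuous_on (sphere 0 1) f"
  shows "(\<lambda>t. f (cis t) * cis (- (of_int m * t))) integrable_on {0..2*pi}"
  by (intro integrable_continuous_interval continuous_intros continuous_on_circle_param assms)

lemma fourier_coeff_cong:
  "(\<And>z. z \<in> sphere 0 1 \<Longrightarrow> f z = g z) \<Longrightarrow> fourier_coeff f m = fourier_coeff g m"
  unfolding fourier_coeff_def by simp

lemma fourier_coeff_add:
  assumes "continuous_on (sphere 0 1) f" "continuous_on (sphere 0 1) g"
  shows "fourier_coeff (\<lambda>z. f z + g z) m = fourier_coeff f m + fourier_coeff g m"
  unfolding fourier_coeff_def distrib_right
  by (simp add: integral_add[OF integrable_fourier[OF assms(1)] integrable_fourier[OF assms(2)]]
        add_divide_distrib)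

lemma fourier_coeff_cmult:
  "fourier_coeff (\<lambda>z. c * f z) m = c * fourier_coeff f m"
  unfolding fourier_coeff_def by (simp add: mult.assoc)

lemma fourier_coeff_diff:
  assumes "continuous_on (sphere 0 1) f" "continuous_on (sphere 0 1) g"
  shows "fourier_coeff (\<lambda>z. f z - g z) m = fourier_coeff f m - fourier_coeff g m"
  unfolding fourier_coeff_def left_diff_distrib
  by (simp add: integral_diff[OF integrable_fourier[OF assms(1)] integrable_fourier[OF assms(2)]]
        diff_divide_distrib)

lemma fourier_coeff_sum:
  assumes "\<And>i. i \<in> I \<Longrightarrow> continuous_on (sphere 0 1) (f i)"
  shows "fourier_coeff (\<lambda>z. \<Sum>i\<in>I. f i z) m = (\<Sum>i\<in>I. fourier_coeff (f i) m)"
  using assms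
proof (induction I rule: infinite_finite_induct)
  case (insert i I)
  then show ?case
    by (simp add: fourier_coeff_add continuous_on_sum)
qed (simp_all add: fourier_coeff_def)

lemma integral_cis:
  "integral {0..2*pi} (\<lambda>t. cis (of_int m * t)) = (if m = 0 then 2 * of_real pi else 0)"
proof (cases "m = 0")
  case False
  have "((\<lambda>t. cis (of_int m * t)) has_integral
      (cis (of_int m * (2*pi)) / (\<i> * of_int m) - cis (of_int m * 0) / (\<i> * of_int m))) {0..2*pi}"
  proof (rule fundamental_theorem_of_calculus)
    fix t :: real
    show "((\<lambda>t. cis (of_int m * t) / (\<i> * of_int m)) has_vector_derivative cis (of_int m * t))
        (at t within {0..2*pi})"
    proof -
      have "((\<lambda>z. exp (\<i> * (of_int m * z)) / (\<i> * of_int m)) has_field_derivative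
          exp (\<i> * (of_int m * of_real t))) (at (of_real t) within A)" for A
        using False by (auto intro!: derivative_eq_intros simp: mult.left_commute[of \<i>])
      from has_vector_derivative_real_field[OF this[of UNIV]] show ?thesis
        by (simp add: cis_conv_exp)
    qed
  qed simp
  moreover have "cis (of_int m * (2*pi)) = 1"
    using cis_power_int[of "2*pi" m] by simp
  ultimately show ?thesis using False by (simp add: integral_unique)
qed (simp add: scaleR_conv_of_real)

lemma fourier_coeff_powi:
  "fourier_coeff (\<lambda>z. z powi n) m = (if m = n then 1 else 0)"
proof -
  have "cis t powi n * cis (- (of_int m * t)) = cis (of_int (n - m) * t)" for t
    by (simp add: cis_power_int cis_mult algebra_simps)
  then show ?thesis
    unfolding fourier_coeff_def using integral_cis[of "n - m"] by simp
qed

lemma fourier_coeff_mult_powi: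
  "fourier_coeff (\<lambda>z. f z * z powi n) m = fourier_coeff f (m - n)"
proof -
  have "f (cis t) * cis t powi n * cis (- (of_int m * t)) = f (cis t) * cis (- (of_int (m - n) * t))"
    for t
  proof -
    have "cis t powi n * cis (- (of_int m * t)) = cis (- (of_int (m - n) * t))"
      unfolding cis_power_int cis_mult by (simp add: algebra_simps)
    then show ?thesis by (simp add: mult.assoc)
  qed
  then show ?thesis
    unfolding fourier_coeff_def by (simp only:)
qed

text \<open>
  Conjugating the argument is the substitution \<open>\<theta> \<mapsto> -\<theta>\<close>;
  periodicity moves the interval of integration back.
\<close>

lemma fourier_coeff_cnj_arg:
  "fourier_coeff (\<lambda>z. f (cnj z)) m = fourier_coeff f (- m)"
proof -
  let ?g = "\<lambda>t. f (cis t) * cis (of_int m * t)"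
  have per: "?g (t + 2*pi) = ?g t" for t
  proof -
    have "cis (of_int m * (t + 2*pi)) = cis (of_int m * t)"
      using cis_power_int[of "2*pi" m] by (simp add: distrib_left flip: cis_mult)
    moreover have "cis (t + 2*pi) = cis t"
      by (simp flip: cis_mult)
    ultimately show ?thesis by simp
  qed
  have "integral {0..2*pi} (\<lambda>t. f (cnj (cis t)) * cis (- (of_int m * t)))
      = integral {0..2*pi} (\<lambda>t. ?g (- t))"
    by (simp add: cis_cnj)
  also have "\<dots> = integral {-(2*pi)..-0} ?g"
    using Henstock_Kurzweil_Integration.integral_reflect_real[where f="?g" and a="-(2*pi)" and b="0"]
    by simp
  also have "\<dots> = integral {-(2*pi)..0} (\<lambda>t. ?g (t + 2*pi))"
    by (simp only: per) simp
  also have "\<dots> = integral {0..2*pi} ?g"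
    using integral_shift_real_ivl[of 0 "2*pi" "2*pi" "?g"] by simp
  finally show ?thesis by (simp add: fourier_coeff_def)
qed

text \<open>
  Termwise integration is allowed because the series converges uniformly by the Weierstrass test.
\<close>

lemma fourier_coeff_suminf:
  assumes cont: "\<And>n. continuous_on (sphere 0 1) (f n)"
    and bd: "\<And>n z. z \<in> sphere 0 1 \<Longrightarrow> norm (f n z) \<le> M n" and "summable M"
  shows "(\<lambda>n. fourier_coeff (f n) m) sums fourier_coeff (\<lambda>z. \<Sum>n. f n z) m" (is ?A)
    and "continuous_on (sphere 0 1) (\<lambda>z. \<Sum>n. f n z)" (is ?B)
proof -
  have ul: "uniform_limit (sphere 0 1) (\<lambda>n z. \<Sum>i<n. f i z) (\<lambda>z. \<Sum>i. f i z) sequentially"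
    by (rule Weierstrass_m_test[OF _ \<open>summable M\<close>]) (use bd in auto)
  show ?B
    by (rule uniform_limit_theorem[OF _ ul]) (auto intro!: always_eventually continuous_on_sum cont)
  have ul2: "uniform_limit {0..2*pi} (\<lambda>n t. (\<Sum>i<n. f i (cis t)) * cis (- (of_int m * t)))
     (\<lambda>t. (\<Sum>i. f i (cis t)) * cis (- (of_int m * t))) sequentially"
  proof (rule uniform_limitI)
    fix e :: real assume "e > 0"
    from uniform_limitD[OF ul this]
    show "\<forall>\<^sub>F n in sequentially. \<forall>t\<in>{0..2*pi}. dist ((\<Sum>i<n. f i (cis t)) * cis (- (of_int m * t)))
       ((\<Sum>i. f i (cis t)) * cis (- (of_int m * t))) < e"
      by eventually_elim (simp add: dist_norm norm_mult flip: left_diff_distrib)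
  qed
  obtain I J where I: "\<And>n. ((\<lambda>t. (\<Sum>i<n. f i (cis t)) * cis (- (of_int m * t))) has_integral I n) {0..2*pi}"
    and J: "((\<lambda>t. (\<Sum>i. f i (cis t)) * cis (- (of_int m * t))) has_integral J) {0..2*pi}"
    and lim: "I \<longlonglongrightarrow> J"
  proof (rule uniform_limit_integral[OF ul2])
    show "continuous_on {0..2*pi} (\<lambda>t. (\<Sum>i<n. f i (cis t)) * cis (- (of_int m * t)))" for n
      using continuous_on_circle_param[OF cont] by (intro continuous_intros)
  qed auto
  have "(\<lambda>n. integral {0..2*pi} (\<lambda>t. (\<Sum>i<n. f i (cis t)) * cis (- (of_int m * t)))) \<longlonglongrightarrow>
      integral {0..2*pi} (\<lambda>t. (\<Sum>i. f i (cis t)) * cis (- (of_int m * t)))"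
    using lim integral_unique[OF I] integral_unique[OF J] by simp
  from tendsto_mult_left[OF this, of "1 / (2 * of_real pi)"]
  have "(\<lambda>n. fourier_coeff (\<lambda>z. \<Sum>i<n. f i z) m) \<longlonglongrightarrow> fourier_coeff (\<lambda>z. \<Sum>n. f n z) m"
    unfolding fourier_coeff_def .
  then show ?A
    by (simp add: sums_def fourier_coeff_sum cont)
qed

text \<open>
  Each monomial contributes to a single frequency, and the series may be integrated term by term.
\<close>

lemma fourier_coeff_power_series:
  assumes "summable (\<lambda>n. norm (a n))"
    and "\<And>z. z \<in> sphere 0 1 \<Longrightarrow> (\<lambda>n. a n * z ^ n) sums f z"
  shows "fourier_coeff f m = (if m \<ge> 0 then a (nat m) else 0)"
proof -
  have "fourier_coeff (\<lambda>z. a n * z ^ n) m = (if int n = m then a n else 0)" for n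
    using fourier_coeff_cmult[of "a n" "\<lambda>z. z ^ n" m] fourier_coeff_powi[of "int n" m]
    by simp
  moreover have "(\<lambda>n. fourier_coeff (\<lambda>z. a n * z ^ n) m) sums fourier_coeff (\<lambda>z. \<Sum>n. a n * z ^ n) m"
  proof (rule fourier_coeff_suminf(1)[OF _ _ assms(1)])
    show "continuous_on (sphere 0 1) (\<lambda>z. a n * z ^ n)" for n by (intro continuous_intros)
    show "norm (a n * z ^ n) \<le> norm (a n)" if "z \<in> sphere 0 1" for n z
      using that by (simp add: norm_mult norm_power)
  qed
  ultimately have "(\<lambda>n. if int n = m then a n else 0) sums fourier_coeff (\<lambda>z. \<Sum>n. a n * z ^ n) m"
    by (simp only:)
  moreover have "fourier_coeff (\<lambda>z. \<Sum>n. a n * z ^ n) m = fourier_coeff f m"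
    by (rule fourier_coeff_cong) (use assms(2) in \<open>auto simp: sums_iff\<close>)
  moreover have "(\<lambda>n. if int n = m then a n else 0) sums (if m \<ge> 0 then a (nat m) else 0)"
  proof (cases "m \<ge> 0")
    case True
    then have "int n = m \<longleftrightarrow> n = nat m" for n by auto
    with True show ?thesis
      using sums_single[of "nat m" a] by simp
  next
    case False
    then have "(\<lambda>n. if int n = m then a n else 0) = (\<lambda>n. 0)" by auto
    with False show ?thesis by simp
  qed
  ultimately show ?thesis
    using sums_unique2 by (simp only:)
qed

section \<open>Orthogonality and best approximation in the mean square\<close>

definition circle_inner :: "(complex \<Rightarrow> complex) \<Rightarrow> (complex \<Rightarrow> complex) \<Rightarrow> complex" where
  "circle_inner f g = integral {0..2*pi} (\<lambda>t. f (cis t) * cnj (g (cis t)))"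

definition circle_energy :: "(complex \<Rightarrow> complex) \<Rightarrow> real" where
  "circle_energy f = integral {0..2*pi} (\<lambda>t. (cmod (f (cis t)))\<^sup>2)"

lemma integrable_circle_inner:
  assumes "continuous_on (sphere 0 1) f" "continuous_on (sphere 0 1) g"
  shows "(\<lambda>t. f (cis t) * cnj (g (cis t))) integrable_on {0..2*pi}"
  by (intro integrable_continuous_interval continuous_intros continuous_on_circle_param assms)

lemma circle_inner_add_left:
  assumes "continuous_on (sphere 0 1) f" "continuous_on (sphere 0 1) g" "continuous_on (sphere 0 1) h"
  shows "circle_inner (\<lambda>z. f z + g z) h = circle_inner f h + circle_inner g h"
  unfolding circle_inner_def distrib_right
  by (simp add: integral_add integrable_circle_inner assms)

lemma circle_inner_diff_left:
  assumes "continuous_on (sphere 0 1) f" "continuous_on (sphere 0 1) g" "continuous_on (sphere 0 1) h"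
  shows "circle_inner (\<lambda>z. f z - g z) h = circle_inner f h - circle_inner g h"
  unfolding circle_inner_def left_diff_distrib
  by (simp add: integral_diff integrable_circle_inner assms)

lemma circle_inner_cmult_left: "circle_inner (\<lambda>z. c * f z) h = c * circle_inner f h"
  unfolding circle_inner_def by (simp add: mult.assoc)

lemma circle_inner_commute: "circle_inner g f = cnj (circle_inner f g)"
  unfolding circle_inner_def
  by (subst integral_cnj) (simp add: mult.commute)

lemma circle_inner_sum_right:
  assumes "continuous_on (sphere 0 1) f" "\<And>i. i \<in> I \<Longrightarrow> continuous_on (sphere 0 1) (g i)"
  shows "circle_inner f (\<lambda>z. \<Sum>i\<in>I. a i * g i z) = (\<Sum>i\<in>I. cnj (a i) * circle_inner f (g i))"
  using assms(2)
proof (induction I rule: infinite_finite_induct)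
  case (insert i I)
  have "circle_inner (\<lambda>z. a i * g i z + (\<Sum>i\<in>I. a i * g i z)) f
      = a i * circle_inner (g i) f + circle_inner (\<lambda>z. \<Sum>i\<in>I. a i * g i z) f"
    by (subst circle_inner_add_left)
       (use insert.prems in \<open>auto intro!: continuous_intros assms(1) simp: circle_inner_cmult_left\<close>)
  then have "circle_inner f (\<lambda>z. a i * g i z + (\<Sum>i\<in>I. a i * g i z))
      = cnj (a i * circle_inner (g i) f + circle_inner (\<lambda>z. \<Sum>i\<in>I. a i * g i z) f)"
    using circle_inner_commute[of f] by (simp only:)
  also have "\<dots> = cnj (a i) * circle_inner f (g i) + circle_inner f (\<lambda>z. \<Sum>i\<in>I. a i * g i z)"
    unfolding circle_inner_commute[of f] by simp
  finally show ?case
    using insert by simp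
qed (simp_all add: circle_inner_def)

lemma circle_inner_self: "circle_inner f f = of_real (circle_energy f)"
proof -
  have "circle_inner f f = integral {0..2*pi} (\<lambda>t. of_real ((cmod (f (cis t)))\<^sup>2))"
    unfolding circle_inner_def complex_norm_square[symmetric] by simp
  also have "\<dots> = of_real (circle_energy f)"
    unfolding circle_energy_def
  proof (cases "(\<lambda>t. (cmod (f (cis t)))\<^sup>2) integrable_on {0..2*pi}")
    case True
    then show "integral {0..2*pi} (\<lambda>t. complex_of_real ((cmod (f (cis t)))\<^sup>2))
        = of_real (integral {0..2*pi} (\<lambda>t. (cmod (f (cis t)))\<^sup>2))"
      by (intro integral_unique has_integral_of_real integrable_integral)
  next
    case False
    moreover have "\<not> (\<lambda>t. complex_of_real ((cmod (f (cis t)))\<^sup>2)) integrable_on {0..2*pi}"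
    proof
      assume "(\<lambda>t. complex_of_real ((cmod (f (cis t)))\<^sup>2)) integrable_on {0..2*pi}"
      from integrable_linear[OF this bounded_linear_Re] False show False by (simp add: o_def)
    qed
    ultimately show "integral {0..2*pi} (\<lambda>t. complex_of_real ((cmod (f (cis t)))\<^sup>2))
        = of_real (integral {0..2*pi} (\<lambda>t. (cmod (f (cis t)))\<^sup>2))"
      by (simp add: not_integrable_integral)
  qed
  finally show ?thesis .
qed

lemma circle_energy_nonneg: "circle_energy f \<ge> 0"
  unfolding circle_energy_def
  by (cases "(\<lambda>t. (cmod (f (cis t)))\<^sup>2) integrable_on {0..2*pi}")
     (auto intro: integral_nonneg simp: not_integrable_integral)

text \<open>
  Continuity is what turns vanishing energy into vanishing at every single point of the circle.
\<close>

lemma circle_energy_eq_0D: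
  assumes "continuous_on (sphere 0 1) f" "circle_energy f = 0" "z \<in> sphere 0 1"
  shows "f z = 0"
proof -
  obtain t where t: "0 \<le> t" "t < 2*pi" "z = cis t"
    using Arg2pi[of z] assms(3) by (auto simp: is_Arg_def cis_conv_exp intro: that[of "Arg2pi z"])
  have cont: "continuous_on {0..2*pi} (\<lambda>t. (cmod (f (cis t)))\<^sup>2)"
    using continuous_on_circle_param[OF assms(1)] by (intro continuous_intros)
  have "((\<lambda>t. (cmod (f (cis t)))\<^sup>2) has_integral 0) (cbox 0 (2*pi))"
    using integrable_integral[OF integrable_continuous_interval[OF cont]] assms(2)
    unfolding circle_energy_def by simp
  then have "(cmod (f (cis t)))\<^sup>2 = 0"
    by (rule has_integral_0_cbox_imp_0[rotated 2])
       (use t cont in auto)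
  then show ?thesis using t by simp
qed

lemma circle_pythagoras:
  assumes f: "continuous_on (sphere 0 1) f" and g: "continuous_on (sphere 0 1) g"
    and "circle_inner f g = 0"
  shows "circle_energy (\<lambda>z. f z + g z) = circle_energy f + circle_energy g"
proof -
  have fg: "continuous_on (sphere 0 1) (\<lambda>z. f z + g z)" by (intro continuous_intros f g)
  have "circle_inner (\<lambda>z. f z + g z) (\<lambda>z. f z + g z)
     = cnj (circle_inner (\<lambda>z. f z + g z) f) + cnj (circle_inner (\<lambda>z. f z + g z) g)"
    by (simp add: circle_inner_add_left[OF f g fg] flip: circle_inner_commute)
  also have "\<dots> = circle_inner f f + circle_inner g g"
    using assms(3) circle_inner_commute[of g f]
    by (simp add: circle_inner_add_left f g circle_inner_self)
  finally show ?thesis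
    unfolding circle_inner_self by (metis of_real_add of_real_eq_iff)
qed

text \<open>
  Gram-Schmidt, one function at a time: from the new function the part in the span of the old ones
  is removed, and then the residual is made orthogonal to what remains. If nothing remains, the
  new function already lies in the span and contributes nothing.
\<close>

lemma exists_orthogonal_projection:
  assumes "finite I" "\<And>i. i \<in> I \<Longrightarrow> continuous_on (sphere 0 1) (g i)"
    and "continuous_on (sphere 0 1) f"
  shows "\<exists>\<alpha>. \<forall>i\<in>I. circle_inner (\<lambda>z. f z - (\<Sum>j\<in>I. \<alpha> j * g j z)) (g i) = 0"
  using assms
proof (induction I arbitrary: f rule: finite_induct)
  case (insert i I)
  have gI: "continuous_on (sphere 0 1) (g j)" if "j \<in> I" for j using insert.prems that by auto
  have gi: "continuous_on (sphere 0 1) (g i)" using insert.prems by auto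
  obtain \<beta> where \<beta>: "\<forall>j\<in>I. circle_inner (\<lambda>z. g i z - (\<Sum>j\<in>I. \<beta> j * g j z)) (g j) = 0"
    using insert.IH[OF gI gi] by auto
  obtain \<gamma> where \<gamma>: "\<forall>j\<in>I. circle_inner (\<lambda>z. f z - (\<Sum>j\<in>I. \<gamma> j * g j z)) (g j) = 0"
    using insert.IH[OF gI insert.prems(2)] by auto
  define g' where "g' = (\<lambda>z. g i z - (\<Sum>j\<in>I. \<beta> j * g j z))"
  define f' where "f' = (\<lambda>z. f z - (\<Sum>j\<in>I. \<gamma> j * g j z))"
  have cg': "continuous_on (sphere 0 1) g'" and cf': "continuous_on (sphere 0 1) f'"
    unfolding g'_def f'_def by (auto intro!: continuous_intros gI gi insert.prems)
  \<comment> \<open>If \<open>g'\<close> vanishes, this is 0, and nothing is subtracted.\<close>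
  define l where "l = circle_inner f' g' / circle_inner g' g'"
  define r where "r = (\<lambda>z. f' z - l * g' z)"
  have cr: "continuous_on (sphere 0 1) r"
    unfolding r_def by (auto intro!: continuous_intros cg' cf')
  have r_left: "circle_inner r h = circle_inner f' h - l * circle_inner g' h"
    if "continuous_on (sphere 0 1) h" for h
    unfolding r_def by (subst circle_inner_diff_left)
      (auto intro!: continuous_intros cg' cf' that simp: circle_inner_cmult_left)
  have rI: "circle_inner r (g j) = 0" if "j \<in> I" for j
    using r_left[OF gI[OF that]] \<beta> \<gamma> that unfolding g'_def f'_def by simp
  have rg': "circle_inner r g' = 0"
  proof (cases "circle_energy g' = 0")
    case True
    then have "g' (cis t) = 0" for t using circle_energy_eq_0D[OF cg', of "cis t"] by simp
    then show ?thesis unfolding circle_inner_def by simp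
  next
    case False
    then show ?thesis using r_left[OF cg'] by (simp add: l_def circle_inner_self)
  qed
  have "circle_inner r (\<lambda>z. \<Sum>j\<in>I. \<beta> j * g j z) = 0"
    by (subst circle_inner_sum_right) (auto intro: cr gI simp: rI)
  moreover have "g i = (\<lambda>z. g' z + (\<Sum>j\<in>I. \<beta> j * g j z))" unfolding g'_def by auto
  moreover have "circle_inner (\<lambda>z. g' z + (\<Sum>j\<in>I. \<beta> j * g j z)) r
     = circle_inner g' r + circle_inner (\<lambda>z. \<Sum>j\<in>I. \<beta> j * g j z) r"
    by (rule circle_inner_add_left) (auto intro!: continuous_intros cg' cr gI)
  ultimately have "circle_inner (g i) r = 0"
    using rg' circle_inner_commute[of r g'] circle_inner_commute[of r "\<lambda>z. \<Sum>j\<in>I. \<beta> j * g j z"]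
    by simp
  then have ri: "circle_inner r (g i) = 0"
    by (subst circle_inner_commute) simp
  define \<alpha> where "\<alpha> = (\<lambda>j. if j = i then l else \<gamma> j - l * \<beta> j)"
  have "f z - (\<Sum>j\<in>insert i I. \<alpha> j * g j z) = r z" for z
  proof -
    have "(\<Sum>j\<in>I. \<alpha> j * g j z) = (\<Sum>j\<in>I. \<gamma> j * g j z - l * (\<beta> j * g j z))"
      using insert.hyps by (intro sum.cong) (auto simp: \<alpha>_def algebra_simps)
    also have "\<dots> = (\<Sum>j\<in>I. \<gamma> j * g j z) - l * (\<Sum>j\<in>I. \<beta> j * g j z)"
      by (simp add: sum_subtractf sum_distrib_left)
    finally show ?thesis
      using insert.hyps by (simp add: r_def f'_def g'_def \<alpha>_def algebra_simps)
  qed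
  then show ?case
    by (intro exI[of _ \<alpha>]) (auto simp: rI ri)
qed auto

text \<open>
  The coefficients of an orthogonal projection minimise the energy, by the theorem of Pythagoras.
\<close>

lemma least_squares_attained:
  assumes I: "finite I" and g: "\<And>i. i \<in> I \<Longrightarrow> continuous_on (sphere 0 1) (g i)"
    and f: "continuous_on (sphere 0 1) f"
  shows "\<exists>\<alpha>. \<forall>\<beta>. circle_energy (\<lambda>z. (\<Sum>j\<in>I. \<alpha> j * g j z) - f z)
                \<le> circle_energy (\<lambda>z. (\<Sum>j\<in>I. \<beta> j * g j z) - f z)"
proof -
  obtain \<alpha> where \<alpha>: "\<forall>i\<in>I. circle_inner (\<lambda>z. f z - (\<Sum>j\<in>I. \<alpha> j * g j z)) (g i) = 0"
    using exists_orthogonal_projection[of I g f] I g f by blast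
  define r where "r = (\<lambda>z. f z - (\<Sum>j\<in>I. \<alpha> j * g j z))"
  have r: "continuous_on (sphere 0 1) r" unfolding r_def by (intro continuous_intros f g)
  have minus: "circle_energy (\<lambda>z. u z - w z) = circle_energy (\<lambda>z. w z - u z)" for u w
    unfolding circle_energy_def by (simp add: norm_minus_commute)
  show ?thesis
  proof (intro exI allI)
    fix \<beta>
    let ?h = "\<lambda>z. \<Sum>j\<in>I. (\<alpha> j - \<beta> j) * g j z"
    have "circle_inner r ?h = 0"
      using \<alpha> by (subst circle_inner_sum_right) (auto intro: r g simp: r_def[symmetric])
    then have "circle_energy r \<le> circle_energy (\<lambda>z. r z + ?h z)"
      using circle_energy_nonneg[of ?h]
      by (subst circle_pythagoras) (auto intro!: continuous_intros r g)
    also have "(\<lambda>z. r z + ?h z) = (\<lambda>z. f z - (\<Sum>j\<in>I. \<beta> j * g j z))"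
      by (auto simp: r_def sum_subtractf left_diff_distrib)
    finally show "circle_energy (\<lambda>z. (\<Sum>j\<in>I. \<alpha> j * g j z) - f z)
                \<le> circle_energy (\<lambda>z. (\<Sum>j\<in>I. \<beta> j * g j z) - f z)"
      unfolding r_def by (subst (1 2) minus)
  qed
qed

section \<open>Energy and Fourier coefficients\<close>

lemma fourier_coeff_conv_inner:
  "circle_inner f (\<lambda>z. z powi m) = 2 * of_real pi * fourier_coeff f m"
  unfolding circle_inner_def fourier_coeff_def by (simp add: cis_power_int cis_cnj)

lemma continuous_on_circle_powi: "continuous_on (sphere 0 1) (\<lambda>z::complex. z powi m)"
  by (intro continuous_intros) auto

text \<open>
  The inductive form makes closure under products a double induction on monomials; the
  coefficients of a member are recovered in \<open>trig_poly_representation\<close>.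
\<close>

inductive trig_poly :: "(complex \<Rightarrow> complex) \<Rightarrow> bool" where
  monomial: "trig_poly (\<lambda>z. c * z powi n)"
| add: "trig_poly f \<Longrightarrow> trig_poly g \<Longrightarrow> trig_poly (\<lambda>z. f z + g z)"

lemma trig_poly_representation:
  assumes "trig_poly g"
  shows "\<exists>F a. finite F \<and> g = (\<lambda>z. \<Sum>m\<in>F. a m * z powi m)"
  using assms
proof induction
  case (monomial c n)
  show ?case by (rule exI[of _ "{n}"], rule exI[of _ "\<lambda>_. c"]) simp
next
  case (add f g)
  then obtain F a G b where F: "finite F" "f = (\<lambda>z. \<Sum>m\<in>F. a m * z powi m)"
    and G: "finite G" "g = (\<lambda>z. \<Sum>m\<in>G. b m * z powi m)" by blast
  define d where "d = (\<lambda>m. (if m \<in> F then a m else 0) + (if m \<in> G then b m else 0))"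
  have "(\<Sum>m\<in>F. a m * z powi m) = (\<Sum>m\<in>F\<union>G. (if m \<in> F then a m else 0) * z powi m)" for z
    by (rule sum.mono_neutral_cong_left) (use F G in auto)
  moreover have "(\<Sum>m\<in>G. b m * z powi m) = (\<Sum>m\<in>F\<union>G. (if m \<in> G then b m else 0) * z powi m)" for z
    by (rule sum.mono_neutral_cong_left) (use F G in auto)
  ultimately have "(\<lambda>z. f z + g z) = (\<lambda>z. \<Sum>m\<in>F\<union>G. d m * z powi m)"
    unfolding F(2) G(2) d_def by (simp add: sum.distrib algebra_simps)
  with F G show ?case by blast
qed

lemma trig_poly_mult:
  assumes "trig_poly f" "trig_poly g"
  shows "\<exists>h. trig_poly h \<and> (\<forall>z\<in>sphere 0 1. f z * g z = h z)"
  using assms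
proof (induction f)
  case (monomial c n)
  from monomial show ?case
  proof (induction g)
    case (monomial d k)
    have "trig_poly (\<lambda>z. (c * d) * z powi (n + k))" by (rule trig_poly.monomial)
    then show ?case
      by (intro exI[of _ "\<lambda>z. (c * d) * z powi (n + k)"]) (auto, subst power_int_add, auto)
  next
    case (add f g)
    then obtain h1 h2 where "trig_poly h1" "\<forall>z\<in>sphere 0 1. c * z powi n * f z = h1 z"
      "trig_poly h2" "\<forall>z\<in>sphere 0 1. c * z powi n * g z = h2 z" by blast
    then show ?case
      by (intro exI[of _ "\<lambda>z. h1 z + h2 z"]) (auto simp: distrib_left intro: trig_poly.add)
  qed
next
  case (add f1 f2)
  then obtain h1 h2 where "trig_poly h1" "\<forall>z\<in>sphere 0 1. f1 z * g z = h1 z"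
    "trig_poly h2" "\<forall>z\<in>sphere 0 1. f2 z * g z = h2 z" by blast
  then show ?case
    by (intro exI[of _ "\<lambda>z. h1 z + h2 z"]) (auto simp: distrib_right intro: trig_poly.add)
qed

text \<open>
  On the unit circle the inverse is the conjugate, so the real and imaginary parts of
  \<open>z\<close> are combinations of \<open>z\<close> and \<open>z\<^bsup>-1\<^esup>\<close>;
  this turns a real linear functional, and with it every real polynomial in the two coordinates,
  into a trigonometric polynomial.
\<close>

lemma real_polynomial_function_trig_poly:
  fixes p :: "complex \<Rightarrow> real"
  assumes "real_polynomial_function p"
  shows "\<exists>h. trig_poly h \<and> (\<forall>z\<in>sphere 0 1. of_real (p z) = h z)"
  using assms
proof induction
  case (linear f)
  interpret bounded_linear f by fact
  let ?a = "(of_real (f 1) - \<i> * of_real (f \<i>)) / 2" and ?b = "(of_real (f 1) + \<i> * of_real (f \<i>)) / 2"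
  have "trig_poly (\<lambda>z. ?a * z powi 1 + ?b * z powi (-1))"
    by (intro trig_poly.intros)
  moreover have "of_real (f z) = ?a * z powi 1 + ?b * z powi (-1)" if "z \<in> sphere 0 1" for z
  proof -
    have "f z = f (Re z *\<^sub>R 1 + Im z *\<^sub>R \<i>)"
      by (rule arg_cong[where f=f]) (simp add: complex_eq_iff)
    also have "\<dots> = Re z * f 1 + Im z * f \<i>" by (simp only: add scaleR) simp
    finally have 1: "f z = Re z * f 1 + Im z * f \<i>" .
    have "z * cnj z = 1" using that by (simp add: complex_norm_square[symmetric])
    then have "inverse z = cnj z" by (metis inverse_unique)
    then show ?thesis unfolding 1 power_int_1_right power_int_minus
      by (simp add: complex_eq_iff algebra_simps flip: add_divide_distrib)
  qed
  ultimately show ?case by blast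
next
  case (const c)
  show ?case
    using trig_poly.monomial[of "of_real c" 0] by auto
next
  case (add f g)
  then obtain h1 h2 where "trig_poly h1" "\<forall>z\<in>sphere 0 1. of_real (f z) = h1 z"
    "trig_poly h2" "\<forall>z\<in>sphere 0 1. of_real (g z) = h2 z" by blast
  then show ?case
    by (intro exI[of _ "\<lambda>z. h1 z + h2 z"]) (auto intro: trig_poly.add)
next
  case (mult f g)
  then obtain h1 h2 where h: "trig_poly h1" "\<forall>z\<in>sphere 0 1. of_real (f z) = h1 z"
    "trig_poly h2" "\<forall>z\<in>sphere 0 1. of_real (g z) = h2 z" by blast
  then show ?case using trig_poly_mult[OF h(1,3)] by auto
qed

lemma trig_poly_dense:
  assumes "continuous_on (sphere 0 1) f" "e > 0"
  shows "\<exists>g. trig_poly g \<and> (\<forall>z\<in>sphere 0 1. cmod (f z - g z) < e)"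
proof -
  obtain p where p: "polynomial_function p" "\<forall>z\<in>sphere 0 1. cmod (f z - p z) < e"
    using Stone_Weierstrass_polynomial_function[OF compact_sphere assms] by blast
  have "real_polynomial_function (Re \<circ> p)" "real_polynomial_function (Im \<circ> p)"
    using p(1) unfolding polynomial_function_def
    by (auto simp: bounded_linear_Re bounded_linear_Im)
  then obtain h1 h2 where h: "trig_poly h1" "\<forall>z\<in>sphere 0 1. of_real (Re (p z)) = h1 z"
    "trig_poly h2" "\<forall>z\<in>sphere 0 1. of_real (Im (p z)) = h2 z"
    using real_polynomial_function_trig_poly[of "Re \<circ> p"] real_polynomial_function_trig_poly[of "Im \<circ> p"]
    by (auto simp: o_def)
  obtain h3 where h3: "trig_poly h3" "\<forall>z\<in>sphere 0 1. \<i> * z powi 0 * h2 z = h3 z"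
    using trig_poly_mult[OF trig_poly.monomial[of \<i> 0] h(3)] by blast
  have "p z = h1 z + h3 z" if "z \<in> sphere 0 1" for z
    using h(2,4) h3(2) that complex_eq[of "p z"] by simp
  with p(2) show ?thesis
    by (intro exI[of _ "\<lambda>z. h1 z + h3 z"]) (auto intro: trig_poly.add h h3)
qed

lemma fourier_coeff_trig_sum:
  assumes "finite F"
  shows "fourier_coeff (\<lambda>z. \<Sum>m\<in>F. a m * z powi m) k = (if k \<in> F then a k else 0)"
proof -
  have "fourier_coeff (\<lambda>z. \<Sum>m\<in>F. a m * z powi m) k = (\<Sum>m\<in>F. if m = k then a m else 0)"
    by (subst fourier_coeff_sum)
       (auto intro!: continuous_intros continuous_on_circle_powi sum.cong
             simp: fourier_coeff_cmult fourier_coeff_powi)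
  also have "\<dots> = (if k \<in> F then a k else 0)" using assms by simp
  finally show ?thesis .
qed

text \<open>
  The nontrivial half of Parseval's identity, in a form that needs no convergence of the Fourier
  series. For a trigonometric polynomial close to \<open>f\<close>, with frequencies in a finite
  set \<open>F\<close>, the partial Fourier sum over \<open>F\<close> is at least as close to
  \<open>f\<close> in the mean square, and its energy is \<open>2 \<pi>\<close> times the sum of
  the squared coefficients over \<open>F\<close>.
\<close>

lemma circle_energy_le_bessel_bound:
  assumes f: "continuous_on (sphere 0 1) f"
    and bd: "\<And>F. finite F \<Longrightarrow> (\<Sum>m\<in>F. (cmod (fourier_coeff f m))\<^sup>2) \<le> K"
  shows "circle_energy f \<le> 2 * pi * K"
proof (rule field_le_epsilon)
  fix e :: real assume e: "e > 0"
  \<comment> \<open>Uniform distance \<open>d\<close> amounts to energy at most \<open>2 \<pi> d\<^sup>2 = e\<close>.\<close>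
  define d where "d = sqrt (e / (2 * pi))"
  have d: "d > 0" "2 * pi * d\<^sup>2 = e" using e by (auto simp: d_def)
  obtain F a where F: "finite F"
    and close: "\<forall>z\<in>sphere 0 1. cmod (f z - (\<Sum>m\<in>F. a m * z powi m)) < d"
    using trig_poly_dense[OF f d(1)] trig_poly_representation by metis
  define c where "c = fourier_coeff f"
  define p where "p = (\<lambda>z. \<Sum>m\<in>F. c m * z powi m)"
  have cS: "continuous_on (sphere 0 1) (\<lambda>z. \<Sum>m\<in>F. b m * z powi m)" for b :: "int \<Rightarrow> complex"
    by (intro continuous_intros) auto
  have cp: "continuous_on (sphere 0 1) p" unfolding p_def by (rule cS)
  have cfp: "continuous_on (sphere 0 1) (\<lambda>z. f z - p z)" by (intro continuous_intros f cp)
  have orth: "circle_inner (\<lambda>z. f z - p z) (\<lambda>z. \<Sum>m\<in>F. b m * z powi m) = 0" for b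
  proof -
    have "fourier_coeff p m = c m" if "m \<in> F" for m
      using that by (simp add: p_def fourier_coeff_trig_sum[OF F])
    then have "circle_inner (\<lambda>z. f z - p z) (\<lambda>z. z powi m) = 0" if "m \<in> F" for m
      using that by (simp add: fourier_coeff_conv_inner fourier_coeff_diff[OF f cp] c_def)
    then show ?thesis
      by (simp add: circle_inner_sum_right[OF cfp continuous_on_circle_powi])
  qed
  have "circle_energy f = circle_energy (\<lambda>z. f z - p z) + circle_energy p"
    using circle_pythagoras[OF cfp cp] orth[of c] by (simp add: p_def)
  also have "circle_energy p = 2 * pi * (\<Sum>m\<in>F. (cmod (c m))\<^sup>2)"
  proof -
    have "circle_inner p (\<lambda>z. \<Sum>m\<in>F. c m * z powi m) = of_real (2 * pi * (\<Sum>m\<in>F. (cmod (c m))\<^sup>2))"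
      unfolding circle_inner_sum_right[OF cp continuous_on_circle_powi] fourier_coeff_conv_inner
      unfolding p_def fourier_coeff_trig_sum[OF F] sum_distrib_left of_real_sum
      by (intro sum.cong) (auto simp: mult.commute simp flip: complex_norm_square)
    then show ?thesis using circle_inner_self[of p] unfolding p_def of_real_eq_iff by (metis of_real_eq_iff)
  qed
  also have "\<dots> \<le> 2 * pi * K" using bd[OF F] unfolding c_def by simp
  also have "circle_energy (\<lambda>z. f z - p z) \<le> e"
  proof -
    let ?b = "\<lambda>m. c m - a m"
    have "circle_energy (\<lambda>z. (f z - p z) + (\<Sum>m\<in>F. ?b m * z powi m))
       = circle_energy (\<lambda>z. f z - p z) + circle_energy (\<lambda>z. \<Sum>m\<in>F. ?b m * z powi m)"
      by (rule circle_pythagoras[OF cfp cS orth])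
    then have "circle_energy (\<lambda>z. f z - p z) \<le> circle_energy (\<lambda>z. (f z - p z) + (\<Sum>m\<in>F. ?b m * z powi m))"
      using circle_energy_nonneg by simp
    also have "\<dots> = circle_energy (\<lambda>z. f z - (\<Sum>m\<in>F. a m * z powi m))"
      by (rule arg_cong[where f=circle_energy]) (auto simp: p_def sum_subtractf left_diff_distrib)
    also have "\<dots> \<le> integral {0..2*pi} (\<lambda>t. d\<^sup>2)"
      unfolding circle_energy_def
    proof (rule integral_le)
      show "(\<lambda>t. (cmod (f (cis t) - (\<Sum>m\<in>F. a m * cis t powi m)))\<^sup>2) integrable_on {0..2 * pi}"
        using continuous_on_circle_param[OF f] continuous_on_circle_param[OF cS[of a]]
        by (intro integrable_continuous_interval continuous_intros) auto
      show "(cmod (f (cis t) - (\<Sum>m\<in>F. a m * cis t powi m)))\<^sup>2 \<le> d\<^sup>2" for t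
        using close by (intro power_mono) (auto intro: less_imp_le)
    qed auto
    also have "\<dots> = e" using d by simp
    finally show ?thesis .
  qed
  finally show "circle_energy f \<le> 2 * pi * K + e" by simp
qed

lemma L2_norm_circle_conv_energy: "L2_norm_circle f = sqrt (circle_energy f)"
  unfolding L2_norm_circle_def circle_energy_def ..

section \<open>Divided powers and the series of the Hankel function\<close>

text \<open>
  The functions \<open>x\<^sup>n/n!\<close>, with the value 0 for negative \<open>n\<close> that
  the pole of the Gamma function dictates. With this convention differentiation lowers the index
  for every integer \<open>n\<close>.
\<close>

definition dpow :: "int \<Rightarrow> complex \<Rightarrow> complex" where
  "dpow n x = (if n < 0 then 0 else x ^ nat n / fact (nat n))"

text \<open>
  Up to a multiple of \<open>dpow\<close>, this is the derivative of
  \<open>x\<^bsup>\<nu>\<^esup>/\<Gamma>(\<nu>+1)\<close> with respect to \<open>\<nu>\<close> at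
  the integer \<open>n\<close>: the digamma value at \<open>n+1\<close> is the harmonic number
  minus the Euler constant, and for negative \<open>n\<close> only the derivative of the
  reciprocal Gamma function survives. The constant \<open>-i\<pi>/2\<close> is the admixture that
  turns the resulting series of \<open>Y\<^sub>0\<close> into that of \<open>H\<^sub>0 = J\<^sub>0
  + iY\<^sub>0\<close>.
\<close>

definition lpow :: "int \<Rightarrow> complex \<Rightarrow> complex" where
  "lpow n x = (if n < 0 then (-1) ^ nat (-n-1) * fact (nat (-n-1)) / x ^ nat (-n)
     else x ^ nat n / fact (nat n) * (Ln x - \<i> * of_real pi / 2 + euler_mascheroni - harm (nat n)))"

lemma dpow_of_nat [simp]: "dpow (int n) x = x ^ n / fact n"
  by (simp add: dpow_def)

lemma lpow_of_nat:
  "lpow (int n) x = x ^ n / fact n * (Ln x - \<i> * of_real pi / 2 + euler_mascheroni - harm n)"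
  by (simp add: lpow_def)

lemma lpow_neg: "lpow (- int (Suc n)) x = (-1) ^ n * fact n / x ^ Suc n"
  by (simp add: lpow_def nat_add_distrib)

lemma int_cases_Suc:
  obtains "n = 0" | p where "n = int (Suc p)" | p where "n = - int (Suc p)"
proof (cases n)
  case (nonneg p)
  then show ?thesis using that(1,2) by (cases p) auto
qed (use that in auto)

lemma dpow_rec: "of_int n * dpow n x = x * dpow (n - 1) x"
proof (cases n rule: int_cases_Suc)
  case (2 p)
  then have "n - 1 = int p" by simp
  then show ?thesis unfolding 2(1) dpow_of_nat \<open>n - 1 = int p\<close>[unfolded 2(1)]
    by (simp add: field_simps del: of_nat_Suc)
qed (auto simp: dpow_def)

text \<open>
  Differentiate \<open>\<nu> x\<^bsup>\<nu>\<^esup>/\<Gamma>(\<nu>+1) = x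
  x\<^bsup>\<nu>-1\<^esup>/\<Gamma>(\<nu>)\<close> with respect to \<open>\<nu>\<close>; the
  product rule on the left yields the extra term.
\<close>

lemma lpow_rec:
  assumes "x \<noteq> 0"
  shows "of_int n * lpow n x = x * lpow (n - 1) x - dpow n x"
proof (cases n rule: int_cases_Suc)
  case 1
  have "lpow (- 1) x = 1 / x" using lpow_neg[of 0 x] by simp
  with 1 assms show ?thesis by (simp add: dpow_def)
next
  case (2 p)
  have *: "int (Suc p) - 1 = int p" by simp
  show ?thesis unfolding 2 dpow_of_nat lpow_of_nat *
    by (simp add: harm_Suc field_simps del: of_nat_Suc)
next
  case (3 p)
  have *: "- int (Suc p) - 1 = - int (Suc (Suc p))" by simp
  show ?thesis unfolding 3 * lpow_neg using assms
    by (simp add: dpow_def field_simps del: of_nat_Suc)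
qed

lemma lpow_has_field_derivative:
  assumes "x \<notin> \<real>\<^sub>\<le>\<^sub>0"
  shows "(lpow n has_field_derivative lpow (n - 1) x) (at x)"
proof (cases n rule: int_cases_Suc)
  case 1
  have "lpow (- 1) x = 1 / x" using lpow_neg[of 0 x] by simp
  then show ?thesis unfolding 1 lpow_def[abs_def] using assms
    by (auto intro!: derivative_eq_intros simp: field_simps)
next
  case (2 p)
  have *: "int (Suc p) - 1 = int p" by simp
  have "x \<noteq> 0" using assms by auto
  have "((\<lambda>x. x ^ Suc p / fact (Suc p)) has_field_derivative x ^ p / fact p) (at x)"
    using DERIV_cdivide[OF DERIV_power[OF DERIV_ident, where n = "Suc p"], of "fact (Suc p)"]
    by (simp del: of_nat_Suc power_Suc)
  moreover have "((\<lambda>x. Ln x - \<i> * of_real pi / 2 + euler_mascheroni - harm (Suc p))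
      has_field_derivative 1 / x) (at x)"
    using assms \<open>x \<noteq> 0\<close> by (auto intro!: derivative_eq_intros simp: field_simps)
  ultimately have "((\<lambda>x. x ^ Suc p / fact (Suc p) * (Ln x - \<i> * of_real pi / 2 + euler_mascheroni - harm (Suc p)))
     has_field_derivative x ^ p / fact p * (Ln x - \<i> * of_real pi / 2 + euler_mascheroni - harm (Suc p))
       + 1 / x * (x ^ Suc p / fact (Suc p))) (at x)"
    by (rule DERIV_mult)
  also have "x ^ p / fact p * (Ln x - \<i> * of_real pi / 2 + euler_mascheroni - harm (Suc p))
       + 1 / x * (x ^ Suc p / fact (Suc p)) = lpow (int p) x"
    using \<open>x \<noteq> 0\<close> by (simp add: lpow_of_nat harm_Suc field_simps del: of_nat_Suc)
  finally have "((\<lambda>x. x ^ Suc p / fact (Suc p) * (Ln x - \<i> * of_real pi / 2 + euler_mascheroni - harm (Suc p)))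
     has_field_derivative lpow (int p) x) (at x)" .
  then show ?thesis unfolding 2 * using lpow_of_nat[of "Suc p", abs_def] by (simp only:)
next
  case (3 p)
  have *: "- int (Suc p) - 1 = - int (Suc (Suc p))" by simp
  have "x \<noteq> 0" using assms by auto
  have "((\<lambda>x. (-1) ^ p * fact p / x ^ Suc p) has_field_derivative
      (-1) ^ Suc p * fact (Suc p) / x ^ Suc (Suc p)) (at x)"
  proof -
    have "((\<lambda>x. x ^ Suc p) has_field_derivative of_nat (Suc p) * x ^ p) (at x)"
      using DERIV_power[OF DERIV_ident, where n = "Suc p"] by (simp del: of_nat_Suc power_Suc)
    moreover have "x ^ Suc p \<noteq> 0" using \<open>x \<noteq> 0\<close> by simp
    ultimately have D: "((\<lambda>x. (-1) ^ p * fact p * inverse (x ^ Suc p)) has_field_derivative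
        (-1) ^ p * fact p * - (of_nat (Suc p) * x ^ p * inverse ((x ^ Suc p) ^ Suc (Suc 0)))) (at x)"
      by (intro DERIV_cmult DERIV_inverse_fun)
    show ?thesis
      unfolding divide_inverse
      by (rule DERIV_cong[OF D]) (use \<open>x \<noteq> 0\<close> in \<open>simp add: field_simps del: of_nat_Suc\<close>)
  qed
  then show ?thesis unfolding 3 * lpow_neg using lpow_neg[of p, abs_def] by (simp only:)
qed

lemma dpow_add:
  "dpow (int n) (x + h) = (\<Sum>q\<le>n. h ^ q / fact q * dpow (int n - int q) x)"
proof -
  have "dpow (int n) (x + h) = (\<Sum>q\<le>n. of_nat (n choose q) * h ^ q * x ^ (n - q)) / fact n"
    by (simp add: add.commute binomial_ring)
  also have "\<dots> = (\<Sum>q\<le>n. h ^ q / fact q * dpow (int n - int q) x)"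
    unfolding sum_divide_distrib
  proof (rule sum.cong)
    fix q assume "q \<in> {..n}"
    then have "dpow (int n - int q) x = x ^ (n - q) / fact (n - q)"
      using dpow_of_nat[of "n - q" x] by (simp add: of_nat_diff)
    moreover have "complex_of_nat (n choose q) = fact n / (fact q * fact (n - q))"
      using \<open>q \<in> {..n}\<close> by (simp add: binomial_fact)
    ultimately show "of_nat (n choose q) * h ^ q * x ^ (n - q) / fact n
        = h ^ q / fact q * dpow (int n - int q) x"
      by simp
  qed simp
  finally show ?thesis .
qed

lemma not_nonpos_Reals_if_near_pos:
  fixes h :: complex
  assumes "norm h < B"
  shows "of_real B + h \<notin> \<real>\<^sub>\<le>\<^sub>0"
proof -
  have "Re (of_real B + h) > 0" using assms abs_Re_le_cmod[of h] by simp
  then show ?thesis by (auto simp: complex_nonpos_Reals_iff)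
qed

text \<open>
  Since differentiation lowers the index, all Taylor coefficients at \<open>B\<close> are again
  values of \<open>lpow\<close>; the series converges up to the singularity at the origin.
\<close>

lemma lpow_taylor:
  assumes "norm h < B"
  shows "(\<lambda>p. h ^ p / fact p * lpow (n - int p) (of_real B)) sums lpow n (of_real B + h)"
proof -
  have nonpos: "x \<notin> \<real>\<^sub>\<le>\<^sub>0" if "x \<in> ball (of_real B) B" for x :: complex
    using not_nonpos_Reals_if_near_pos[of "x - of_real B" B] that
    by (simp add: dist_norm norm_minus_commute)
  have "lpow n holomorphic_on ball (of_real B) B"
    by (rule holomorphic_onI)
       (use lpow_has_field_derivative[OF nonpos] field_differentiable_def field_differentiable_at_within in blast)
  moreover have "of_real B + h \<in> ball (of_real B) B" using assms by (simp add: dist_norm)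
  ultimately have S: "(\<lambda>p. (deriv ^^ p) (lpow n) (of_real B) / fact p * (of_real B + h - of_real B) ^ p)
      sums lpow n (of_real B + h)"
    by (rule holomorphic_power_series)
  have "(deriv ^^ p) (lpow n) x = lpow (n - int p) x" if "x \<in> ball (of_real B) B" for x p
    using that
  proof (induction p arbitrary: x)
    case (Suc p)
    have "((deriv ^^ p) (lpow n) has_field_derivative lpow (n - int p - 1) x) (at x)"
      by (rule has_field_derivative_transform_within_open[OF
            lpow_has_field_derivative[OF nonpos[OF Suc.prems]] open_ball Suc.prems])
         (use Suc.IH in auto)
    then show ?case by (simp add: DERIV_imp_deriv algebra_simps)
  qed simp
  moreover have "(of_real B :: complex) \<in> ball (of_real B) B"
    using assms by (metis centre_in_ball le_less_trans norm_ge_zero)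
  ultimately show ?thesis using S by (simp add: mult.commute)
qed

lemma harm_le_self: "harm n \<le> (of_nat n :: real)"
proof (induction n)
  case (Suc n)
  have "inverse (of_nat (Suc n)) \<le> (1::real)" by (simp add: field_simps)
  with Suc show ?case by (simp add: harm_Suc)
qed (simp add: harm_def)

text \<open>
  The harmonic number is absorbed by doubling the argument, which leaves a bound by the terms of
  an exponential series.
\<close>

lemma norm_lpow_le:
  assumes "norm (Ln x - \<i> * of_real pi / 2 + euler_mascheroni) \<le> c" "norm x \<le> r"
  shows "norm (lpow (int n) x) \<le> (c + 1) * (2 * r) ^ n / fact n"
proof -
  have c: "c \<ge> 0" and r: "r \<ge> 0" using assms norm_ge_zero order_trans by blast+
  have "norm (harm n :: complex) \<le> of_nat n"
    using harm_le_self[of n] harm_nonneg[of n]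
    by (metis abs_of_nonneg norm_of_real of_real_harm)
  then have "norm (Ln x - \<i> * of_real pi / 2 + euler_mascheroni - harm n) \<le> c + of_nat n"
    using assms(1) norm_triangle_ineq4[of "Ln x - \<i> * of_real pi / 2 + euler_mascheroni" "harm n"]
    by simp
  also have "\<dots> \<le> (c + 1) * 2 ^ n"
  proof -
    have "real n \<le> 2 ^ n" by (rule of_nat_less_two_power[THEN less_imp_le])
    moreover have "c * 1 \<le> c * 2 ^ n" using c by (intro mult_left_mono) auto
    ultimately show ?thesis unfolding distrib_right by linarith
  qed
  finally have "norm (lpow (int n) x) \<le> r ^ n / fact n * ((c + 1) * 2 ^ n)"
    unfolding lpow_of_nat norm_mult norm_divide norm_power norm_fact
    using r assms(2) by (intro mult_mono divide_right_mono power_mono) auto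
  then show ?thesis by (simp add: power_mult_distrib mult_ac)
qed

lemma power_div_fact_le_exp: "x \<ge> 0 \<Longrightarrow> x ^ n / fact n \<le> exp (x::real)"
  using sum_le_suminf[OF summable_exp[of x], of "{n}"]
  by (simp add: exp_def divide_inverse mult.commute)

lemma summable_power_div_fact: "summable (\<lambda>n. x ^ n / fact n :: real)"
  using summable_exp[of x] by (simp add: divide_inverse mult.commute)

lemma suminf_power_div_fact: "(\<Sum>n. x ^ n / fact n :: real) = exp x"
  by (simp add: exp_def divide_inverse mult.commute)

lemma bessel_J_sums:
  "(\<lambda>q. (-1) ^ q * x ^ (m + 2 * q) / (fact q * fact (m + q))) sums bessel_J (int m) (2 * x)"
proof -
  have "rGamma (of_int (int m) + of_nat q + 1 :: real) = 1 / fact (m + q)" for q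
    using Gamma_fact[of "m + q", where ?'a = real]
    by (simp add: rGamma_inverse_Gamma field_simps)
  moreover have "int m + 2 * int q = int (m + 2 * q)" for q by simp
  ultimately have eq: "bessel_J (int m) (2 * x) = (\<Sum>q. (-1) ^ q * x ^ (m + 2 * q) / (fact q * fact (m + q)))"
    unfolding bessel_J_def by (simp only: power_int_of_nat) simp
  have "summable (\<lambda>q. (-1) ^ q * x ^ (m + 2 * q) / (fact q * fact (m + q)))"
  proof (rule summable_comparison_test)
    show "summable (\<lambda>q. \<bar>x\<bar> ^ m * ((x\<^sup>2) ^ q / fact q))"
      by (intro summable_mult summable_power_div_fact)
    have "\<bar>x\<bar> ^ m * (x\<^sup>2) ^ q / (fact q * fact (m + q)) \<le> \<bar>x\<bar> ^ m * (x\<^sup>2) ^ q / (fact q * 1)" for q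
      by (intro divide_left_mono mult_left_mono) auto
    then show "\<exists>N. \<forall>q\<ge>N. norm ((-1) ^ q * x ^ (m + 2 * q) / (fact q * fact (m + q)))
        \<le> \<bar>x\<bar> ^ m * ((x\<^sup>2) ^ q / fact q)"
      by (simp add: abs_mult power_abs power_add power_mult)
  qed
  then show ?thesis unfolding eq by (rule summable_sums)
qed

text \<open>
  The logarithm of \<open>\<bar>x\<bar>\<^sup>2\<close> is the sum of the logarithms of
  \<open>x\<close> and of its conjugate. This splits each term of the ascending series into
  products of a function of \<open>x\<close> and a function of the conjugate.
\<close>

lemma hankel1_0_sums:
  assumes "x \<notin> \<real>\<^sub>\<le>\<^sub>0"
  shows "(\<lambda>j. \<i> / of_real pi * (-1) ^ j * (lpow (int j) x * dpow (int j) (cnj x)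
            + dpow (int j) x * lpow (int j) (cnj x))) sums hankel1_0 (2 * cmod x)"
proof -
  define r where "r = cmod x"
  have r: "r > 0" using assms by (auto simp: r_def)
  have J: "(\<lambda>j. (-1) ^ j * (r\<^sup>2) ^ j / (fact j)\<^sup>2) sums bessel_J 0 (2 * r)"
    using bessel_J_sums[of r 0] by (simp add: power_mult power2_eq_square)
  have "summable (\<lambda>j. (-1) ^ (j + 1) * harm j * (r\<^sup>2) ^ j / (fact j)\<^sup>2)"
  proof (rule summable_comparison_test)
    show "summable (\<lambda>j. (r\<^sup>2) ^ j / fact j)" by (rule summable_power_div_fact)
    have "harm j * (r\<^sup>2) ^ j / (fact j)\<^sup>2 \<le> (r\<^sup>2) ^ j / fact j" for j
    proof -
      have "harm j \<le> (fact j :: real)"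
        using harm_le_self[of j] fact_ge_self[of j] by (metis of_nat_fact of_nat_le_iff order_trans)
      then have "harm j * ((r\<^sup>2) ^ j / (fact j)\<^sup>2) \<le> fact j * ((r\<^sup>2) ^ j / (fact j)\<^sup>2)"
        by (intro mult_right_mono) auto
      then show ?thesis by (simp add: power2_eq_square)
    qed
    then show "\<exists>N. \<forall>j\<ge>N. norm ((-1) ^ (j + 1) * harm j * (r\<^sup>2) ^ j / (fact j)\<^sup>2) \<le> (r\<^sup>2) ^ j / fact j"
      by (simp add: abs_mult harm_nonneg)
  qed
  then obtain S where S: "(\<lambda>j. (-1) ^ (j + 1) * harm j * (r\<^sup>2) ^ j / (fact j)\<^sup>2) sums S"
    by (auto simp: summable_def)
  have Y: "bessel_Y0 (2 * r) = 2 / pi * ((ln r + euler_mascheroni) * bessel_J 0 (2 * r) + S)"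
    using S by (simp add: bessel_Y0_def sums_iff power_mult_distrib)
  define c where "c = \<i> / of_real pi * (2 * of_real (ln r) - \<i> * of_real pi + 2 * euler_mascheroni)"
  have "(\<lambda>j. c * of_real ((-1) ^ j * (r\<^sup>2) ^ j / (fact j)\<^sup>2)
        + 2 * \<i> / of_real pi * of_real ((-1) ^ (j + 1) * harm j * (r\<^sup>2) ^ j / (fact j)\<^sup>2))
     sums (c * of_real (bessel_J 0 (2 * r)) + 2 * \<i> / of_real pi * of_real S)"
    by (intro sums_add sums_mult sums_of_real J S)
  also have "c * of_real (bessel_J 0 (2 * r)) + 2 * \<i> / of_real pi * of_real S = hankel1_0 (2 * r)"
  proof -
    define g where "g = (euler_mascheroni :: real)"
    have "(euler_mascheroni :: complex) = of_real g" by (simp add: g_def)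
    then have "c = Complex 1 (2 / pi * (ln r + g))"
      unfolding c_def by (simp add: complex_eq_iff field_simps)
    then show ?thesis
      unfolding hankel1_0_def Y complex_eq_iff g_def[symmetric] by (simp add: algebra_simps add_divide_distrib)
  qed
  also have "(\<lambda>j. c * of_real ((-1) ^ j * (r\<^sup>2) ^ j / (fact j)\<^sup>2)
        + 2 * \<i> / of_real pi * of_real ((-1) ^ (j + 1) * harm j * (r\<^sup>2) ^ j / (fact j)\<^sup>2))
    = (\<lambda>j. \<i> / of_real pi * (-1) ^ j * (lpow (int j) x * dpow (int j) (cnj x)
            + dpow (int j) x * lpow (int j) (cnj x)))"
  proof
    fix j
    have "x \<noteq> 0" using assms by auto
    have ln: "Ln (cnj x) = 2 * of_real (ln r) - Ln x"
      using cnj_Ln[OF assms] \<open>x \<noteq> 0\<close> by (simp add: r_def complex_eq_iff)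
    have xx: "x ^ j * cnj x ^ j = of_real ((r\<^sup>2) ^ j)"
      using complex_norm_square[of x] by (simp add: r_def flip: power_mult_distrib)
    have "lpow (int j) x * dpow (int j) (cnj x) + dpow (int j) x * lpow (int j) (cnj x)
       = (x ^ j * cnj x ^ j) / (fact j)\<^sup>2 * (2 * of_real (ln r) - \<i> * of_real pi + 2 * euler_mascheroni - 2 * harm j)"
      unfolding lpow_of_nat dpow_of_nat ln by (simp add: field_simps power2_eq_square)
    also have "x ^ j * cnj x ^ j = of_real ((r\<^sup>2) ^ j)" by (rule xx)
    finally have 1: "lpow (int j) x * dpow (int j) (cnj x) + dpow (int j) x * lpow (int j) (cnj x)
       = of_real ((r\<^sup>2) ^ j) / (fact j)\<^sup>2 * (2 * of_real (ln r) - \<i> * of_real pi + 2 * euler_mascheroni - 2 * harm j)" .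
    have 2: "complex_of_real ((-1) ^ j * (r\<^sup>2) ^ j / (fact j)\<^sup>2) = (-1) ^ j * (of_real ((r\<^sup>2) ^ j) / (fact j)\<^sup>2)"
      "complex_of_real ((-1) ^ (j + 1) * harm j * (r\<^sup>2) ^ j / (fact j)\<^sup>2)
         = - ((-1) ^ j * harm j * (of_real ((r\<^sup>2) ^ j) / (fact j)\<^sup>2))"
      by (simp_all add: of_real_harm)
    have ring: "P * K * (a * E) + 2 * P * - (a * H * E) = P * a * (E * (K - 2 * H))"
      for P K a E H :: complex by (simp add: algebra_simps)
    show "c * of_real ((-1) ^ j * (r\<^sup>2) ^ j / (fact j)\<^sup>2)
        + 2 * \<i> / of_real pi * of_real ((-1) ^ (j + 1) * harm j * (r\<^sup>2) ^ j / (fact j)\<^sup>2)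
      = \<i> / of_real pi * (-1) ^ j * (lpow (int j) x * dpow (int j) (cnj x)
            + dpow (int j) x * lpow (int j) (cnj x))"
      unfolding 1 2 c_def using ring by (simp only: times_divide_eq_right[symmetric] mult.assoc)
  qed
  finally show ?thesis by (simp add: r_def)
qed

section \<open>Fourier coefficients of the field of a point charge\<close>

lemma continuous_on_lpow_affine:
  assumes "norm h < B"
  shows "continuous_on (sphere 0 1) (\<lambda>z. lpow n (of_real B + h * z))"
proof (intro continuous_at_imp_continuous_on ballI)
  fix z :: complex assume "z \<in> sphere 0 1"
  then have "norm (h * z) < B" using assms by (simp add: norm_mult)
  then have "isCont (lpow n) (of_real B + h * z)"
    by (intro DERIV_isCont[OF lpow_has_field_derivative] not_nonpos_Reals_if_near_pos)
  then show "isCont (\<lambda>z. lpow n (of_real B + h * z)) z"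
    by (rule isCont_o2[rotated]) (intro continuous_intros)
qed

lemma fourier_coeff_lpow_affine:
  assumes "norm h < B"
  shows "fourier_coeff (\<lambda>z. lpow n (of_real B + h * z)) m =
    (if m \<ge> 0 then h ^ nat m / fact (nat m) * lpow (n - int (nat m)) (of_real B) else 0)"
proof (rule fourier_coeff_power_series[where a = "\<lambda>p. h ^ p / fact p * lpow (n - int p) (of_real B)"])
  fix z :: complex assume "z \<in> sphere 0 1"
  then have "norm (h * z) < B" using assms by (simp add: norm_mult)
  from lpow_taylor[OF this, of n]
  show "(\<lambda>p. h ^ p / fact p * lpow (n - int p) (of_real B) * z ^ p) sums lpow n (of_real B + h * z)"
    by (simp add: power_mult_distrib mult_ac)
next
  define r where "r = (norm h + B) / 2"
  have r: "norm h < r" "r < B" "r > 0"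
    using assms norm_ge_zero[of h] le_less_trans[OF norm_ge_zero assms] unfolding r_def
    by (simp_all add: add_nonneg_pos)
  have "norm (complex_of_real r) < B" using r by simp
  from sums_summable[OF lpow_taylor[OF this, of n]]
  have "summable (\<lambda>p. lpow (n - int p) (of_real B) / fact p * of_real r ^ p)"
    by (simp add: mult_ac)
  from powser_insidea[OF this, of h] r
  show "summable (\<lambda>p. norm (h ^ p / fact p * lpow (n - int p) (of_real B)))"
    by (simp add: mult_ac norm_mult norm_divide)
qed

text \<open>
  On the circle the second factor is a polynomial in \<open>z\<^bsup>-1\<^esup>\<close>, so it
  merely shifts the frequencies of the first one.
\<close>

lemma fourier_coeff_lpow_dpow:
  assumes "norm h < B"
  shows "fourier_coeff (\<lambda>z. lpow (int j) (of_real B + h * z) * dpow (int j) (cnj (of_real B + h * z))) m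
    = (\<Sum>q\<le>j. (cnj h ^ q / fact q * dpow (int j - int q) (of_real B)) *
        (if m + int q \<ge> 0 then h ^ nat (m + int q) / fact (nat (m + int q))
            * lpow (int j - int (nat (m + int q))) (of_real B) else 0))"
proof -
  let ?b = "\<lambda>q. cnj h ^ q / fact q * dpow (int j - int q) (of_real B)"
  let ?f = "\<lambda>z. lpow (int j) (of_real B + h * z)"
  have "?f z * dpow (int j) (cnj (of_real B + h * z)) = (\<Sum>q\<le>j. ?b q * (?f z * z powi (- int q)))"
    if "z \<in> sphere 0 1" for z
  proof -
    have "z * cnj z = 1" using that complex_norm_square[of z] by simp
    then have cnj: "cnj z = inverse z" by (metis inverse_unique)
    have "dpow (int j) (cnj (of_real B + h * z)) = (\<Sum>q\<le>j. ?b q * z powi (- int q))"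
      using dpow_add[of j "of_real B" "cnj h * cnj z"]
      by (simp add: cnj power_int_minus power_mult_distrib power_inverse mult_ac)
    then show ?thesis by (simp add: sum_distrib_left mult_ac)
  qed
  then have "fourier_coeff (\<lambda>z. ?f z * dpow (int j) (cnj (of_real B + h * z))) m
      = fourier_coeff (\<lambda>z. \<Sum>q\<le>j. ?b q * (?f z * z powi (- int q))) m"
    by (rule fourier_coeff_cong)
  also have "\<dots> = (\<Sum>q\<le>j. ?b q * fourier_coeff ?f (m + int q))"
  proof (subst fourier_coeff_sum)
    show "continuous_on (sphere 0 1) (\<lambda>z. ?b q * (?f z * z powi (- int q)))" for q
      by (intro continuous_on_mult continuous_on_const continuous_on_lpow_affine
            continuous_on_circle_powi assms)
  qed (simp only: fourier_coeff_cmult fourier_coeff_mult_powi diff_minus_eq_add)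
  finally show ?thesis
    unfolding fourier_coeff_lpow_affine[OF assms] .
qed

text \<open>
  Up to the factor \<open>(-1)\<^sup>m i/\<pi>\<close> the Hankel function of order
  \<open>m\<close> at \<open>2x\<close>.
\<close>

definition hankel_coeff :: "nat \<Rightarrow> complex \<Rightarrow> complex" where
  "hankel_coeff m x = (\<Sum>i. (-1) ^ i * (lpow (int i - int m) x * dpow (int i) x
      + dpow (int i - int m) x * lpow (int i) x))"

text \<open>
  The Bessel function of order \<open>m\<close> at \<open>2x\<close>, up to the sign
  \<open>(-1)\<^sup>m\<close>, written with the same pattern of indices as
  \<open>hankel_coeff\<close> so that both obey the same recurrence.
\<close>

definition bessel_coeff :: "nat \<Rightarrow> complex \<Rightarrow> complex" where
  "bessel_coeff m x = (\<Sum>i. (-1) ^ i * (dpow (int i - int m) x * dpow (int i) x))"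

lemma norm_dpow_le:
  assumes "norm x \<le> r"
  shows "norm (dpow (int n) x) \<le> (2 * r) ^ n / fact n"
proof -
  have "r \<ge> 0" using assms norm_ge_zero order_trans by blast
  then have "norm x ^ n \<le> (2 * r) ^ n" using assms by (intro power_mono) auto
  then show ?thesis by (simp add: norm_divide norm_power divide_right_mono)
qed

lemma hankel_coeff_term_bound:
  assumes "norm (Ln x - \<i> * of_real pi / 2 + euler_mascheroni) \<le> c" "norm x \<le> r" "i \<ge> m"
  shows "norm ((-1) ^ i * (lpow (int i - int m) x * dpow (int i) x + dpow (int i - int m) x * lpow (int i) x))
    \<le> 2 * (c + 1) * exp (2 * r) * ((2 * r) ^ i / fact i)"
proof -
  have r: "r \<ge> 0" using assms(2) norm_ge_zero order_trans by blast
  have c: "c \<ge> 0" using assms(1) norm_ge_zero order_trans by blast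
  have im: "int i - int m = int (i - m)" using assms(3) by simp
  let ?E = "(2 * r) ^ (i - m) / fact (i - m)" and ?F = "(2 * r) ^ i / fact i"
  have E: "?E \<le> exp (2 * r)" "?E \<ge> 0" "?F \<ge> 0" using r power_div_fact_le_exp[of "2 * r" "i - m"] by simp_all
  have "norm (lpow (int (i - m)) x * dpow (int i) x) \<le> ((c + 1) * ?E) * ?F"
    unfolding norm_mult
    using norm_lpow_le[OF assms(1,2), of "i - m"] norm_dpow_le[OF assms(2), of i] c E
    by (intro mult_mono mult_nonneg_nonneg norm_ge_zero) (simp_all only: times_divide_eq_right)
  moreover have "norm (dpow (int (i - m)) x * lpow (int i) x) \<le> ?E * ((c + 1) * ?F)"
    unfolding norm_mult
    using norm_lpow_le[OF assms(1,2), of i] norm_dpow_le[OF assms(2), of "i - m"] c E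
    by (intro mult_mono mult_nonneg_nonneg norm_ge_zero) (simp_all only: times_divide_eq_right)
  ultimately have "norm (lpow (int (i - m)) x * dpow (int i) x + dpow (int (i - m)) x * lpow (int i) x)
      \<le> ((c + 1) * ?E) * ?F + ?E * ((c + 1) * ?F)"
    by (rule norm_triangle_mono)
  also have "\<dots> = 2 * (c + 1) * ?E * ?F" by (simp only: mult_ac) simp
  also have "\<dots> \<le> 2 * (c + 1) * exp (2 * r) * ?F"
    using E c by (intro mult_right_mono mult_left_mono) auto
  finally show ?thesis unfolding im by (simp add: norm_mult norm_power)
qed

lemma summable_hankel_coeff:
  "summable (\<lambda>i. norm ((-1) ^ i * (lpow (int i - int m) x * dpow (int i) x
      + dpow (int i - int m) x * lpow (int i) x)))"
proof (rule summable_comparison_test)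
  let ?c = "norm (Ln x - \<i> * of_real pi / 2 + euler_mascheroni)"
  show "summable (\<lambda>i. 2 * (?c + 1) * exp (2 * norm x) * ((2 * norm x) ^ i / fact i))"
    by (intro summable_mult summable_power_div_fact)
  show "\<exists>N. \<forall>i\<ge>N. norm (norm ((-1) ^ i * (lpow (int i - int m) x * dpow (int i) x
      + dpow (int i - int m) x * lpow (int i) x))) \<le> 2 * (?c + 1) * exp (2 * norm x) * ((2 * norm x) ^ i / fact i)"
    unfolding real_norm_def abs_norm_cancel using hankel_coeff_term_bound[OF order_refl order_refl] by blast
qed

lemma bessel_coeff_sums:
  "(\<lambda>q. (-1) ^ q * ((- of_real x) ^ (m + q) / fact (m + q) * ((- of_real x) ^ q / fact q)) :: complex)
     sums ((-1) ^ m * of_real (bessel_J (int m) (2 * x)))"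
proof -
  have "(\<lambda>q. (-1) ^ m * complex_of_real ((-1) ^ q * x ^ (m + 2 * q) / (fact q * fact (m + q))))
     sums ((-1) ^ m * of_real (bessel_J (int m) (2 * x)))"
    by (intro sums_mult sums_of_real bessel_J_sums)
  moreover have "(-1) ^ m * complex_of_real ((-1) ^ q * x ^ (m + 2 * q) / (fact q * fact (m + q)))
     = (-1) ^ q * ((- of_real x) ^ (m + q) / fact (m + q) * ((- of_real x) ^ q / fact q))" for q
  proof -
    have "x ^ (m + 2 * q) = x ^ (m + q) * x ^ q" by (simp add: mult_2 flip: power_add add.assoc)
    then show ?thesis
      by (cases "even q"; cases "even m") simp_all
  qed
  ultimately show ?thesis by (simp only:)
qed

lemma summable_bessel_coeff:
  "summable (\<lambda>i. norm ((-1) ^ i * (dpow (int i - int m) x * dpow (int i) x)))"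
proof (rule summable_comparison_test)
  show "summable (\<lambda>i. exp (2 * norm x) * ((2 * norm x) ^ i / fact i))"
    by (intro summable_mult summable_power_div_fact)
  have "norm (dpow (int i - int m) x * dpow (int i) x) \<le> exp (2 * norm x) * ((2 * norm x) ^ i / fact i)"
    if "i \<ge> m" for i
  proof -
    have im: "int i - int m = int (i - m)" using that by simp
    have "norm (dpow (int (i - m)) x) \<le> exp (2 * norm x)"
      by (rule order_trans[OF norm_dpow_le[OF order_refl] power_div_fact_le_exp]) simp
    then show ?thesis
      unfolding norm_mult im
      by (intro mult_mono norm_dpow_le[OF order_refl]) simp_all
  qed
  then show "\<exists>N. \<forall>i\<ge>N. norm (norm ((-1) ^ i * (dpow (int i - int m) x * dpow (int i) x)))
      \<le> exp (2 * norm x) * ((2 * norm x) ^ i / fact i)"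
    by (intro exI[of _ m]) (simp add: norm_mult norm_power del: dpow_of_nat)
qed

lemma bessel_coeff_eq:
  "bessel_coeff m (of_real x) = (-1) ^ m * of_real (bessel_J (int m) (2 * x))"
proof -
  let ?t = "\<lambda>i. (-1) ^ i * (dpow (int i - int m) (of_real x) * dpow (int i) (of_real x))"
  have "?t i = 0" if "i < m" for i using that by (simp add: dpow_def)
  moreover have "?t (q + m) = (-1) ^ q * ((- of_real x) ^ (m + q) / fact (m + q) * ((- of_real x) ^ q / fact q))" for q
  proof -
    have "int (q + m) - int m = int q" by simp
    then show ?thesis
      unfolding dpow_of_nat by (cases "even q"; cases "even m") (simp_all add: mult.commute add.commute)
  qed
  ultimately have "?t sums ((-1) ^ m * of_real (bessel_J (int m) (2 * x)))"
    using sums_zero_iff_shift[of m ?t] bessel_coeff_sums[of x m] by (simp only:)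
  then show ?thesis unfolding bessel_coeff_def by (simp add: sums_iff)
qed

text \<open>
  The two products are mirror images of each other: the second becomes the first one for the
  conjugate of \<open>w\<close> when the argument is conjugated. In both cases the frequency
  \<open>m\<close> arises from pairing the power \<open>m + q\<close> of one expansion with the
  power \<open>q\<close> of the other, and the value depends on \<open>q\<close> and \<open>j -
  q\<close> in separate factors.
\<close>

lemma kernel_term_coeff:
  fixes A B :: real and w :: complex
  assumes "0 \<le> A" "A < B" "norm w = 1"
  defines "h \<equiv> - (of_real A * w)"
  defines "x \<equiv> \<lambda>z. of_real B + h * z"
  shows "fourier_coeff (\<lambda>z. lpow (int j) (x z) * dpow (int j) (cnj (x z))
            + dpow (int j) (x z) * lpow (int j) (cnj (x z))) (int m)
    = w ^ m * (\<Sum>q\<le>j. ((- of_real A) ^ (m + q) / fact (m + q) * ((- of_real A) ^ q / fact q)) *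
        (lpow (int (j - q) - int m) (of_real B) * dpow (int (j - q)) (of_real B)
         + dpow (int (j - q) - int m) (of_real B) * lpow (int (j - q)) (of_real B)))"
proof -
  let ?a = "\<lambda>q. (- of_real A) ^ (m + q) / fact (m + q) * ((- of_real A) ^ q / fact q) :: complex"
  have h: "norm h < B" "norm (cnj h) < B" using assms by (auto simp: h_def norm_mult)
  have w1: "w * cnj w = 1" using assms(3) complex_norm_square[of w] by simp
  have hpow: "h ^ (m + q) * cnj h ^ q = w ^ m * ((- of_real A) ^ (m + q) * (- of_real A) ^ q)" for q
  proof -
    have "h ^ (m + q) * cnj h ^ q = (- of_real A) ^ (m + q) * (- of_real A) ^ q * (w ^ m * (w * cnj w) ^ q)"
      unfolding h_def minus_mult_left power_mult_distrib complex_cnj_mult by (simp add: power_add mult_ac)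
    then show ?thesis unfolding w1 by (simp add: mult_ac)
  qed
  have cont1: "continuous_on (sphere 0 1) (\<lambda>z. lpow (int j) (x z) * dpow (int j) (cnj (x z)))"
    unfolding x_def dpow_of_nat
    by (intro continuous_intros continuous_on_lpow_affine h) auto
  have "continuous_on (sphere 0 1) (\<lambda>z. lpow (int j) (of_real B + cnj h * cnj z))"
    by (rule continuous_on_compose2[OF continuous_on_lpow_affine[OF h(2)]]) (auto intro!: continuous_intros)
  then have cont2: "continuous_on (sphere 0 1) (\<lambda>z. dpow (int j) (x z) * lpow (int j) (cnj (x z)))"
    unfolding x_def dpow_of_nat
    by (intro continuous_intros) auto
  have "fourier_coeff (\<lambda>z. lpow (int j) (x z) * dpow (int j) (cnj (x z))) (int m)
     = (\<Sum>q\<le>j. w ^ m * (?a q * (lpow (int (j - q) - int m) (of_real B) * dpow (int (j - q)) (of_real B))))"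
    unfolding x_def fourier_coeff_lpow_dpow[OF h(1)]
  proof (rule sum.cong)
    fix q assume "q \<in> {..j}"
    then have e: "int j - int q = int (j - q)" "int j - int (m + q) = int (j - q) - int m"
      "nat (int m + int q) = m + q" "int m + int q \<ge> 0" by auto
    show "cnj h ^ q / fact q * dpow (int j - int q) (of_real B) *
         (if 0 \<le> int m + int q then h ^ nat (int m + int q) / fact (nat (int m + int q)) *
               lpow (int j - int (nat (int m + int q))) (of_real B) else 0) =
         w ^ m * (?a q * (lpow (int (j - q) - int m) (of_real B) * dpow (int (j - q)) (of_real B)))"
      using hpow[of q] e(4) unfolding e(1,3) e(2) if_P[OF e(4)] times_divide_times_eq
      by (simp add: mult_ac del: dpow_of_nat)
  qed simp
  moreover have "fourier_coeff (\<lambda>z. dpow (int j) (x z) * lpow (int j) (cnj (x z))) (int m)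
     = (\<Sum>q\<le>j. w ^ m * (?a q * (dpow (int (j - q) - int m) (of_real B) * lpow (int (j - q)) (of_real B))))"
  proof -
    have "fourier_coeff (\<lambda>z. dpow (int j) (x z) * lpow (int j) (cnj (x z))) (int m)
       = fourier_coeff (\<lambda>z. (\<lambda>z. lpow (int j) (of_real B + cnj h * z) * dpow (int j) (cnj (of_real B + cnj h * z))) (cnj z)) (int m)"
      by (rule fourier_coeff_cong) (simp add: x_def mult.commute)
    also have "\<dots> = fourier_coeff (\<lambda>z. lpow (int j) (of_real B + cnj h * z) * dpow (int j) (cnj (of_real B + cnj h * z))) (- int m)"
      by (rule fourier_coeff_cnj_arg)
    also have "\<dots> = (\<Sum>q\<le>j. h ^ q / fact q * dpow (int j - int q) (of_real B) *
        (if - int m + int q \<ge> 0 then cnj h ^ nat (- int m + int q) / fact (nat (- int m + int q))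
            * lpow (int j - int (nat (- int m + int q))) (of_real B) else 0))"
      unfolding fourier_coeff_lpow_dpow[OF h(2)] by simp
    also have "\<dots> = (\<Sum>q\<in>{m..j}. h ^ q / fact q * dpow (int j - int q) (of_real B) *
        (cnj h ^ (q - m) / fact (q - m) * lpow (int j - int (q - m)) (of_real B)))"
    proof (rule sum.mono_neutral_cong_right)
      fix q assume "q \<in> {m..j}"
      then have "nat (- int m + int q) = q - m" "- int m + int q \<ge> 0" by auto
      then show "h ^ q / fact q * dpow (int j - int q) (of_real B) *
        (if - int m + int q \<ge> 0 then cnj h ^ nat (- int m + int q) / fact (nat (- int m + int q))
            * lpow (int j - int (nat (- int m + int q))) (of_real B) else 0)
        = h ^ q / fact q * dpow (int j - int q) (of_real B) *
        (cnj h ^ (q - m) / fact (q - m) * lpow (int j - int (q - m)) (of_real B))"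
        by (simp only: if_True)
    qed auto
    also have "\<dots> = (\<Sum>q\<in>{q. q + m \<le> j}. h ^ (m + q) / fact (m + q) * dpow (int j - int (m + q)) (of_real B) *
        (cnj h ^ q / fact q * lpow (int j - int q) (of_real B)))"
      by (rule sum.reindex_bij_witness[of _ "\<lambda>q. m + q" "\<lambda>q. q - m"]) auto
    also have "\<dots> = (\<Sum>q\<le>j. h ^ (m + q) / fact (m + q) * dpow (int j - int (m + q)) (of_real B) *
        (cnj h ^ q / fact q * lpow (int j - int q) (of_real B)))"
      by (rule sum.mono_neutral_left) (auto simp: dpow_def)
    also have "\<dots> = (\<Sum>q\<le>j. w ^ m * (?a q * (dpow (int (j - q) - int m) (of_real B) * lpow (int (j - q)) (of_real B))))"
    proof (rule sum.cong)
      fix q assume "q \<in> {..j}"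
      then have e: "int j - int q = int (j - q)" "int j - int (m + q) = int (j - q) - int m" by auto
      show "h ^ (m + q) / fact (m + q) * dpow (int j - int (m + q)) (of_real B) *
        (cnj h ^ q / fact q * lpow (int j - int q) (of_real B))
        = w ^ m * (?a q * (dpow (int (j - q) - int m) (of_real B) * lpow (int (j - q)) (of_real B)))"
        using hpow[of q] unfolding e times_divide_times_eq
        by (simp add: mult_ac)
    qed simp
    finally show ?thesis .
  qed
  ultimately show ?thesis
    unfolding fourier_coeff_add[OF cont1 cont2] sum_distrib_left
    by (simp only: sum.distrib[symmetric] distrib_left)
qed

text \<open>
  Graf's addition theorem for the Hankel function of order zero, one Fourier coefficient at a
  time. By \<open>kernel_term_coeff\<close> the coefficient of the \<open>j\<close>-th term is the
  \<open>j\<close>-th entry of a Cauchy product whose factors are the series of a Bessel function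
  at the inner radius and of a Hankel function at the outer radius.
\<close>

lemma kernel_fourier:
  fixes A B :: real and w :: complex
  assumes "0 \<le> A" "A < B" "norm w = 1"
  defines "x \<equiv> \<lambda>z. of_real B + - (of_real A * w) * z"
  shows "continuous_on (sphere 0 1) (\<lambda>z. hankel1_0 (2 * cmod (x z)))" (is ?cont)
    and "fourier_coeff (\<lambda>z. hankel1_0 (2 * cmod (x z))) (int m)
      = \<i> / of_real pi * (-1) ^ m * of_real (bessel_J (int m) (2 * A)) * hankel_coeff m (of_real B) * w ^ m"
      (is ?coeff)
proof -
  define h where "h = - (of_real A * w)"
  have h: "norm h < B" "norm (cnj h) < B" using assms by (auto simp: h_def norm_mult)
  have x: "x z = of_real B + h * z" for z by (simp add: x_def h_def)
  define u where "u = (\<lambda>j z. \<i> / of_real pi * (-1) ^ j * (lpow (int j) (x z) * dpow (int j) (cnj (x z))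
            + dpow (int j) (x z) * lpow (int j) (cnj (x z))))"
  have pos: "x z \<notin> \<real>\<^sub>\<le>\<^sub>0" if "z \<in> sphere 0 1" for z
    unfolding x using that h by (intro not_nonpos_Reals_if_near_pos) (simp add: norm_mult)
  have usums: "(\<lambda>j. u j z) sums hankel1_0 (2 * cmod (x z))" if "z \<in> sphere 0 1" for z
    unfolding u_def by (rule hankel1_0_sums[OF pos[OF that]])
  have cx: "continuous_on (sphere 0 1) x" unfolding x_def by (intro continuous_intros)
  have cont: "continuous_on (sphere 0 1) (u j)" for j
  proof -
    have 1: "continuous_on (sphere 0 1) (\<lambda>z. lpow (int j) (x z))"
      unfolding x by (rule continuous_on_lpow_affine[OF h(1)])
    have "continuous_on (sphere 0 1) (\<lambda>z. lpow (int j) (of_real B + cnj h * cnj z))"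
      by (rule continuous_on_compose2[OF continuous_on_lpow_affine[OF h(2)]]) (auto intro!: continuous_intros)
    then have 2: "continuous_on (sphere 0 1) (\<lambda>z. lpow (int j) (cnj (x z)))" by (simp add: x)
    show ?thesis
      unfolding u_def dpow_of_nat by (intro continuous_intros 1 2 cx) auto
  qed
  have "continuous_on (sphere 0 1) (\<lambda>z. Ln (x z))"
    by (intro continuous_intros cx) (use pos in auto)
  then have "bounded ((\<lambda>z. Ln (x z)) ` sphere 0 1)"
    by (intro compact_imp_bounded compact_continuous_image) auto
  then obtain L where L: "norm (Ln (x z)) \<le> L" if "z \<in> sphere 0 1" for z
    unfolding bounded_iff by blast
  define c where "c = L + norm (\<i> * of_real pi / 2 - euler_mascheroni :: complex)"
  have Lc: "norm (y - \<i> * of_real pi / 2 + euler_mascheroni) \<le> c" if "norm y \<le> L" for y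
    using norm_triangle_ineq4[of y "\<i> * of_real pi / 2 - euler_mascheroni"] that
    unfolding c_def by (simp add: algebra_simps)
  have bound: "norm (u j z) \<le> 2 * (c + 1) * exp (2 * (2 * B)) * ((2 * (2 * B)) ^ j / fact j)"
    if z: "z \<in> sphere 0 1" for j z
  proof -
    have xB: "norm (x z) \<le> 2 * B"
      using norm_triangle_ineq[of "of_real B" "h * z"] z h(1) assms(1,2)
      unfolding x norm_mult by simp
    have Ln1: "norm (Ln (x z) - \<i> * of_real pi / 2 + euler_mascheroni) \<le> c"
      by (rule Lc[OF L[OF z]])
    have Ln2: "norm (Ln (cnj (x z)) - \<i> * of_real pi / 2 + euler_mascheroni) \<le> c"
      using cnj_Ln[OF pos[OF z]] L[OF z] by (intro Lc) (metis complex_mod_cnj)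
    let ?F = "(2 * (2 * B)) ^ j / fact j"
    have B: "B \<ge> 0" using assms by linarith
    have c: "c \<ge> 0" using Ln1 norm_ge_zero order_trans by blast
    have F: "0 \<le> ?F" "?F \<le> exp (2 * (2 * B))"
      using B power_div_fact_le_exp[of "2 * (2 * B)" j] by auto
    have xB': "norm (cnj (x z)) \<le> 2 * B" using xB by simp
    have "norm (lpow (int j) (x z) * dpow (int j) (cnj (x z))) \<le> ((c + 1) * ?F) * ?F"
      unfolding norm_mult using norm_lpow_le[OF Ln1 xB, of j] norm_dpow_le[OF xB', of j] c F
      by (intro mult_mono mult_nonneg_nonneg norm_ge_zero) (simp_all only: times_divide_eq_right)
    moreover have "norm (dpow (int j) (x z) * lpow (int j) (cnj (x z))) \<le> ?F * ((c + 1) * ?F)"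
      unfolding norm_mult using norm_lpow_le[OF Ln2 xB', of j] norm_dpow_le[OF xB, of j] c F
      by (intro mult_mono mult_nonneg_nonneg norm_ge_zero) (simp_all only: times_divide_eq_right)
    ultimately have "norm (lpow (int j) (x z) * dpow (int j) (cnj (x z))
            + dpow (int j) (x z) * lpow (int j) (cnj (x z))) \<le> ((c + 1) * ?F) * ?F + ?F * ((c + 1) * ?F)"
      by (rule norm_triangle_mono)
    also have "\<dots> = 2 * (c + 1) * ?F * ?F" by (simp only: mult_ac) simp
    also have "\<dots> \<le> 2 * (c + 1) * exp (2 * (2 * B)) * ?F"
      using F c by (intro mult_right_mono mult_left_mono) auto
    finally have S: "norm (lpow (int j) (x z) * dpow (int j) (cnj (x z))
            + dpow (int j) (x z) * lpow (int j) (cnj (x z))) \<le> 2 * (c + 1) * exp (2 * (2 * B)) * ?F" .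
    have "norm (\<i> / of_real pi * (-1) ^ j) \<le> 1"
      using pi_ge_two by (simp add: norm_mult norm_divide norm_power field_simps)
    from mult_mono[OF this S] show ?thesis
      unfolding u_def norm_mult by simp
  qed
  note M_test = summable_mult[OF summable_power_div_fact[of "2 * (2 * B)"], of "2 * (c + 1) * exp (2 * (2 * B))"]
  have suminf_cont: "continuous_on (sphere 0 1) (\<lambda>z. \<Sum>j. u j z)"
    by (rule fourier_coeff_suminf(2)[OF cont _ M_test]) (rule bound)
  have suminf_coeff: "(\<lambda>j. fourier_coeff (u j) (int m)) sums fourier_coeff (\<lambda>z. \<Sum>j. u j z) (int m)"
    by (rule fourier_coeff_suminf(1)[OF cont _ M_test]) (rule bound)
  have eq: "(\<Sum>j. u j z) = hankel1_0 (2 * cmod (x z))" if "z \<in> sphere 0 1" for z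
    using usums[OF that] by (simp add: sums_iff)
  show ?cont
    using suminf_cont by (rule continuous_on_eq) (rule eq)
  define \<alpha> where "\<alpha> = (\<lambda>q. (-1) ^ q * ((- of_real A) ^ (m + q) / fact (m + q) * ((- of_real A) ^ q / fact q)) :: complex)"
  define \<beta> where "\<beta> = (\<lambda>i. (-1) ^ i * (lpow (int i - int m) (of_real B) * dpow (int i) (of_real B)
      + dpow (int i - int m) (of_real B) * lpow (int i) (of_real B)))"
  have "fourier_coeff (u j) (int m) = \<i> / of_real pi * w ^ m * (\<Sum>q\<le>j. \<alpha> q * \<beta> (j - q))" for j
  proof -
    have eq1: "(-1) ^ j * (\<Sum>q\<le>j. ((- of_real A) ^ (m + q) / fact (m + q) * ((- of_real A) ^ q / fact q)) *
        (lpow (int (j - q) - int m) (of_real B) * dpow (int (j - q)) (of_real B)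
         + dpow (int (j - q) - int m) (of_real B) * lpow (int (j - q)) (of_real B)))
       = (\<Sum>q\<le>j. \<alpha> q * \<beta> (j - q))"
      unfolding sum_distrib_left
    proof (rule sum.cong)
      fix q assume "q \<in> {..j}"
      then have "(-1 :: complex) ^ j = (-1) ^ q * (-1) ^ (j - q)" by (simp flip: power_add)
      then show "(-1) ^ j * (((- of_real A) ^ (m + q) / fact (m + q) * ((- of_real A) ^ q / fact q)) *
        (lpow (int (j - q) - int m) (of_real B) * dpow (int (j - q)) (of_real B)
         + dpow (int (j - q) - int m) (of_real B) * lpow (int (j - q)) (of_real B))) = \<alpha> q * \<beta> (j - q)"
        unfolding \<alpha>_def \<beta>_def by (simp only: mult_ac)
    qed simp
    show ?thesis
      unfolding u_def fourier_coeff_cmult x_def kernel_term_coeff[OF assms(1-3)] eq1[symmetric]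
      by (simp only: mult_ac)
  qed
  moreover have "(\<lambda>j. \<Sum>q\<le>j. \<alpha> q * \<beta> (j - q)) sums ((\<Sum>q. \<alpha> q) * (\<Sum>i. \<beta> i))"
  proof (rule Cauchy_product_sums)
    show "summable (\<lambda>i. norm (\<beta> i))" unfolding \<beta>_def by (rule summable_hankel_coeff)
    show "summable (\<lambda>q. norm (\<alpha> q))"
    proof (rule summable_comparison_test)
      show "summable (\<lambda>q. exp A * (A ^ q / fact q))" by (intro summable_mult summable_power_div_fact)
      have "norm (\<alpha> q) \<le> exp A * (A ^ q / fact q)" for q
      proof -
        have "norm (\<alpha> q) = A ^ (m + q) / fact (m + q) * (A ^ q / fact q)"
          using assms(1) by (simp add: \<alpha>_def norm_mult norm_divide norm_power)
        also have "\<dots> \<le> exp A * (A ^ q / fact q)"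
          using assms(1) by (intro mult_right_mono power_div_fact_le_exp) auto
        finally show ?thesis .
      qed
      then show "\<exists>N. \<forall>q\<ge>N. norm (norm (\<alpha> q)) \<le> exp A * (A ^ q / fact q)" by simp
    qed
  qed
  ultimately have "(\<lambda>j. fourier_coeff (u j) (int m)) sums
      (\<i> / of_real pi * w ^ m * ((\<Sum>q. \<alpha> q) * (\<Sum>i. \<beta> i)))"
    using sums_mult by (simp only:)
  with suminf_coeff have "fourier_coeff (\<lambda>z. \<Sum>j. u j z) (int m)
      = \<i> / of_real pi * w ^ m * ((\<Sum>q. \<alpha> q) * (\<Sum>i. \<beta> i))"
    by (rule sums_unique2)
  also have "(\<Sum>q. \<alpha> q) = (-1) ^ m * of_real (bessel_J (int m) (2 * A))"
    unfolding \<alpha>_def using bessel_coeff_sums[of A m] by (simp only: sums_iff)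
  also have "(\<Sum>i. \<beta> i) = hankel_coeff m (of_real B)"
    unfolding \<beta>_def hankel_coeff_def ..
  also have "fourier_coeff (\<lambda>z. \<Sum>j. u j z) (int m) = fourier_coeff (\<lambda>z. hankel1_0 (2 * cmod (x z))) (int m)"
    by (rule fourier_coeff_cong) (rule eq)
  finally show ?coeff by (simp only: mult_ac)
qed

section \<open>Three-term recurrences\<close>

text \<open>
  A recurrence between neighbouring terms, with the index of summation shifted by one in one of
  the three places, sums to the three-term recurrence of cylinder functions.
\<close>

lemma suminf_cylinder_recurrence:
  fixes t :: "nat \<Rightarrow> nat \<Rightarrow> complex"
  assumes summable: "\<And>M. summable (t M)"
    and head: "of_nat (Suc m) * t (Suc m) 0 = - x * t (Suc (Suc m)) 0"
    and tail: "\<And>i. of_nat (Suc m) * t (Suc m) (Suc i) = - x * t m i - x * t (Suc (Suc m)) (Suc i)"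
  shows "x * (suminf (t m) + suminf (t (Suc (Suc m)))) = - of_nat (Suc m) * suminf (t (Suc m))"
proof -
  have S: "summable (\<lambda>i. t M (Suc i))" for M using summable by (simp add: summable_Suc_iff)
  have "of_nat (Suc m) * suminf (t (Suc m))
      = of_nat (Suc m) * t (Suc m) 0 + (\<Sum>i. of_nat (Suc m) * t (Suc m) (Suc i))"
    unfolding suminf_mult[OF S[of "Suc m"]] suminf_split_head[OF summable[of "Suc m"]]
    by (simp only: right_diff_distrib) simp
  also have "(\<Sum>i. of_nat (Suc m) * t (Suc m) (Suc i))
      = - x * suminf (t m) - x * (\<Sum>i. t (Suc (Suc m)) (Suc i))"
    unfolding tail suminf_mult[OF summable, symmetric] suminf_mult[OF S, symmetric]
    by (rule suminf_diff[symmetric]) (intro summable_mult summable S)+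
  also have "(\<Sum>i. t (Suc (Suc m)) (Suc i)) = suminf (t (Suc (Suc m))) - t (Suc (Suc m)) 0"
    by (rule suminf_split_head[OF summable])
  finally have "of_nat (Suc m) * suminf (t (Suc m)) = - x * suminf (t m) - x * suminf (t (Suc (Suc m)))"
    unfolding head by (simp add: algebra_simps del: of_nat_Suc)
  then show ?thesis by (simp add: distrib_left del: of_nat_Suc)
qed

lemma alternating_sign_step:
  fixes n x a b c :: complex
  assumes "n * a = x * b - x * c"
  shows "n * ((-1) ^ Suc i * a) = - x * ((-1) ^ i * b) - x * ((-1) ^ Suc i * c)"
proof -
  have "n * ((-1) ^ Suc i * a) = (-1) ^ Suc i * (n * a)" by (rule mult.left_commute)
  also have "\<dots> = - x * ((-1) ^ i * b) - x * ((-1) ^ Suc i * c)"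
    unfolding assms by (simp add: algebra_simps)
  finally show ?thesis .
qed

text \<open>
  For \<open>M = m + 1\<close> write the factor \<open>M\<close> as \<open>i - (i - M)\<close> and
  let either part act on the entry with that index through \<open>dpow_rec\<close> and
  \<open>lpow_rec\<close>; the extra terms of \<open>lpow_rec\<close> cancel.
\<close>

lemma hankel_coeff_rec:
  assumes "x \<noteq> 0"
  shows "x * (hankel_coeff m x + hankel_coeff (Suc (Suc m)) x) = - of_nat (Suc m) * hankel_coeff (Suc m) x"
  unfolding hankel_coeff_def
proof (rule suminf_cylinder_recurrence)
  fix M show "summable (\<lambda>i. (- 1) ^ i * (lpow (int i - int M) x * dpow (int i) x + dpow (int i - int M) x * lpow (int i) x))"
    by (rule summable_norm_cancel[OF summable_hankel_coeff])
next
  have *: "of_nat (Suc m) * (lpow (i - int (Suc m)) x * dpow i x + dpow (i - int (Suc m)) x * lpow i x)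
     = x * (lpow (i - 1 - int m) x * dpow (i - 1) x + dpow (i - 1 - int m) x * lpow (i - 1) x)
       - x * (lpow (i - int (Suc (Suc m))) x * dpow i x + dpow (i - int (Suc (Suc m))) x * lpow i x)" for i
  proof -
    define n where "n = i - int (Suc m)"
    have n: "i - 1 - int m = n" "i - int (Suc (Suc m)) = n - 1" "of_nat (Suc m) = (of_int i - of_int n :: complex)"
      by (simp_all add: n_def)
    have "(of_int i - of_int n) * (lpow n x * dpow i x + dpow n x * lpow i x)
       = lpow n x * (of_int i * dpow i x) - (of_int n * lpow n x) * dpow i x
         + dpow n x * (of_int i * lpow i x) - (of_int n * dpow n x) * lpow i x"
      by (simp add: algebra_simps)
    also have "\<dots> = x * (lpow n x * dpow (i - 1) x + dpow n x * lpow (i - 1) x)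
       - x * (lpow (n - 1) x * dpow i x + dpow (n - 1) x * lpow i x)"
      unfolding dpow_rec lpow_rec[OF assms] by (simp add: algebra_simps)
    finally show ?thesis unfolding n n_def[symmetric] .
  qed
  show "of_nat (Suc m) * ((- 1) ^ 0 * (lpow (int 0 - int (Suc m)) x * dpow (int 0) x
      + dpow (int 0 - int (Suc m)) x * lpow (int 0) x))
    = - x * ((- 1) ^ 0 * (lpow (int 0 - int (Suc (Suc m))) x * dpow (int 0) x
      + dpow (int 0 - int (Suc (Suc m))) x * lpow (int 0) x))"
    using *[of "int 0"] by (simp add: dpow_def)
  fix i
  have i: "int (Suc i) - 1 = int i" by simp
  show "of_nat (Suc m) * ((- 1) ^ Suc i * (lpow (int (Suc i) - int (Suc m)) x * dpow (int (Suc i)) x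
      + dpow (int (Suc i) - int (Suc m)) x * lpow (int (Suc i)) x))
    = - x * ((- 1) ^ i * (lpow (int i - int m) x * dpow (int i) x + dpow (int i - int m) x * lpow (int i) x))
     - x * ((- 1) ^ Suc i * (lpow (int (Suc i) - int (Suc (Suc m))) x * dpow (int (Suc i)) x
      + dpow (int (Suc i) - int (Suc (Suc m))) x * lpow (int (Suc i)) x))"
    (is "?n * (?s * ?a) = - x * (?r * ?b) - x * (?s * ?c)")
  proof -
    have "?n * ?a = x * ?b - x * ?c" using *[of "int (Suc i)"] unfolding i .
    then show ?thesis by (rule alternating_sign_step)
  qed
qed

lemma bessel_coeff_rec:
  "x * (bessel_coeff m x + bessel_coeff (Suc (Suc m)) x) = - of_nat (Suc m) * bessel_coeff (Suc m) x"
  unfolding bessel_coeff_def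
proof (rule suminf_cylinder_recurrence)
  fix M show "summable (\<lambda>i. (- 1) ^ i * (dpow (int i - int M) x * dpow (int i) x))"
    by (rule summable_norm_cancel[OF summable_bessel_coeff])
next
  have *: "of_nat (Suc m) * (dpow (i - int (Suc m)) x * dpow i x)
     = x * (dpow (i - 1 - int m) x * dpow (i - 1) x) - x * (dpow (i - int (Suc (Suc m))) x * dpow i x)" for i
  proof -
    define n where "n = i - int (Suc m)"
    have n: "i - 1 - int m = n" "i - int (Suc (Suc m)) = n - 1" "of_nat (Suc m) = (of_int i - of_int n :: complex)"
      by (simp_all add: n_def)
    have "(of_int i - of_int n) * (dpow n x * dpow i x)
       = dpow n x * (of_int i * dpow i x) - (of_int n * dpow n x) * dpow i x"
      by (simp add: algebra_simps)
    also have "\<dots> = x * (dpow n x * dpow (i - 1) x) - x * (dpow (n - 1) x * dpow i x)"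
      unfolding dpow_rec by (simp add: algebra_simps)
    finally show ?thesis unfolding n n_def[symmetric] .
  qed
  show "of_nat (Suc m) * ((- 1) ^ 0 * (dpow (int 0 - int (Suc m)) x * dpow (int 0) x))
    = - x * ((- 1) ^ 0 * (dpow (int 0 - int (Suc (Suc m))) x * dpow (int 0) x))"
    by (simp add: dpow_def)
  fix i
  have i: "int (Suc i) - 1 = int i" by simp
  show "of_nat (Suc m) * ((- 1) ^ Suc i * (dpow (int (Suc i) - int (Suc m)) x * dpow (int (Suc i)) x))
    = - x * ((- 1) ^ i * (dpow (int i - int m) x * dpow (int i) x))
     - x * ((- 1) ^ Suc i * (dpow (int (Suc i) - int (Suc (Suc m))) x * dpow (int (Suc i)) x))"
    (is "?n * (?s * ?a) = - x * (?r * ?b) - x * (?s * ?c)")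
  proof -
    have "?n * ?a = x * ?b - x * ?c" using *[of "int (Suc i)"] unfolding i .
    then show ?thesis by (rule alternating_sign_step)
  qed
qed

text \<open>
  At a positive argument \<open>J\<^sub>m\<close> and \<open>Y\<^sub>m\<close> are real, so the
  combination \<open>J\<^sub>m + iY\<^sub>m\<close> vanishes only if both do. In the present
  normalisation \<open>J\<^sub>m\<close> appears as the imaginary part.
\<close>

lemma bessel_coeff_eq_0_if_hankel_coeff_eq_0:
  assumes "B > 0" "hankel_coeff m (of_real B) = 0"
  shows "bessel_coeff m (of_real B) = 0"
proof -
  let ?x = "complex_of_real B"
  have d: "dpow n ?x = of_real (Re (dpow n ?x))" for n
  proof -
    have "dpow n ?x = of_real (if n < 0 then 0 else B ^ nat n / fact (nat n))"
      by (simp add: dpow_def)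
    then show ?thesis by (simp only: Re_complex_of_real)
  qed
  have l: "Im (lpow n ?x) = - pi / 2 * Re (dpow n ?x)" for n
  proof (cases "n < 0")
    case True
    then have "lpow n ?x = of_real ((-1) ^ nat (-n-1) * fact (nat (-n-1)) / B ^ nat (-n))"
      by (simp add: lpow_def)
    then have "Im (lpow n ?x) = 0" by (simp only: Im_complex_of_real)
    with True show ?thesis by (simp add: dpow_def)
  next
    case False
    define g where "g = B ^ nat n / fact (nat n)"
    define e where "e = ln B + euler_mascheroni - harm (nat n)"
    have "Ln ?x = of_real (ln B)" using assms(1) by (rule Ln_of_real)
    with False have "lpow n ?x = of_real g * (of_real e - \<i> * of_real (pi / 2))"
      by (simp add: lpow_def g_def e_def of_real_harm algebra_simps)
    moreover have "dpow n ?x = of_real g" using False by (simp add: dpow_def g_def)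
    ultimately show ?thesis by simp
  qed
  let ?t = "\<lambda>i. (-1) ^ i * (lpow (int i - int m) ?x * dpow (int i) ?x + dpow (int i - int m) ?x * lpow (int i) ?x)"
  let ?s = "\<lambda>i. (-1) ^ i * (dpow (int i - int m) ?x * dpow (int i) ?x)"
  have "Im (?t i) = - pi * Re (?s i)" for i
  proof -
    define a b where "a = Re (dpow (int i - int m) ?x)" and "b = Re (dpow (int i) ?x)"
    have [simp]: "dpow (int i - int m) ?x = of_real a" "dpow (int i) ?x = of_real b"
      "Im (lpow (int i - int m) ?x) = - pi / 2 * a" "Im (lpow (int i) ?x) = - pi / 2 * b"
      using d l unfolding a_def b_def by blast+
    have s: "(-1 :: complex) ^ i = of_real ((-1) ^ i)" by simp
    show ?thesis unfolding s by (simp add: algebra_simps del: dpow_of_nat of_real_power)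
  qed
  then have "Im (suminf ?t) = - pi * Re (suminf ?s)"
    using sums_Im[OF summable_sums[OF summable_norm_cancel[OF summable_hankel_coeff]], of m ?x]
      sums_mult[OF sums_Re[OF summable_sums[OF summable_norm_cancel[OF summable_bessel_coeff]], of m ?x], of "- pi"]
    by (simp only:) (rule sums_unique2)
  then have "Re (bessel_coeff m ?x) = 0"
    using assms(2) by (simp add: hankel_coeff_def bessel_coeff_def)
  moreover have "bessel_coeff m ?x = of_real ((-1) ^ m * bessel_J (int m) (2 * B))"
    by (simp add: bessel_coeff_eq)
  ultimately show ?thesis by simp
qed

section \<open>Asymptotics in the order and absence of zeros\<close>

lemma suminf_near_1:
  fixes f :: "nat \<Rightarrow> 'a :: {banach, real_normed_algebra_1}"
  assumes "f sums s" "g sums G" "\<And>i. norm (f i - (if i = 0 then 1 else 0)) \<le> g i"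
  shows "norm (s - 1) \<le> G"
proof -
  have "(\<lambda>i. f i - (if i = 0 then 1 else 0)) sums (s - 1)"
    by (intro sums_diff assms(1) sums_single)
  with assms(2,3) show ?thesis
    by (metis (no_types, lifting) norm_suminf_le sums_iff)
qed

lemma fact_ratio_le:
  assumes "1 \<le> q" "q \<le> n"
  shows "fact (n - q) / fact n \<le> (1 / n :: real)"
proof -
  have "fact (n - q) * real n \<le> fact (n - 1) * real n"
    using assms by (intro mult_right_mono fact_mono) auto
  also have "\<dots> = fact n" using assms by (simp add: fact_reduce mult.commute)
  finally show ?thesis using assms by (simp add: field_simps)
qed

text \<open>
  The first term of the ascending series dominates: relative to it, every other term carries a
  factor at most \<open>1/(m+1)\<close>.
\<close>

lemma bessel_J_asymp:
  assumes "x > 0"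
  shows "(\<lambda>m. bessel_J (int m) (2 * x) * fact m / x ^ m) \<longlonglongrightarrow> 1"
proof -
  have bound: "norm (bessel_J (int m) (2 * x) * fact m / x ^ m - 1) \<le> exp (x\<^sup>2) * (1 / real (Suc m))" for m
  proof (rule suminf_near_1)
    let ?t = "\<lambda>q. (-1) ^ q * x ^ (m + 2 * q) / (fact q * fact (m + q)) * (fact m / x ^ m)"
    show "?t sums (bessel_J (int m) (2 * x) * fact m / x ^ m)"
      using sums_mult2[OF bessel_J_sums[of x m], of "fact m / x ^ m"] by simp
    show "(\<lambda>q. (x\<^sup>2) ^ q / fact q * (1 / real (Suc m))) sums (exp (x\<^sup>2) * (1 / real (Suc m)))"
      using summable_sums[OF summable_power_div_fact[of "x\<^sup>2"]] unfolding suminf_power_div_fact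
      by (rule sums_mult2)
    fix q
    have t: "?t q = (-1) ^ q * ((x\<^sup>2) ^ q / fact q) * (fact m / fact (m + q))"
      using assms by (simp add: power_add power_mult)
    show "norm (?t q - (if q = 0 then 1 else 0)) \<le> (x\<^sup>2) ^ q / fact q * (1 / real (Suc m))"
    proof (cases "q = 0")
      case False
      have "fact m * real (Suc m) \<le> fact (m + q)"
        using fact_mono[of "Suc m" "m + q", where ?'a = real] False by (simp add: mult.commute)
      then have "fact m / fact (m + q) \<le> 1 / real (Suc m)"
        by (simp add: field_simps del: of_nat_Suc)
      then have "(x\<^sup>2) ^ q / fact q * (fact m / fact (m + q)) \<le> (x\<^sup>2) ^ q / fact q * (1 / real (Suc m))"
        by (intro mult_left_mono) auto
      then show ?thesis unfolding t using False by (simp add: abs_mult)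
    qed (use t in simp)
  qed
  have "(\<lambda>m. exp (x\<^sup>2) * (1 / real (Suc m))) \<longlonglongrightarrow> exp (x\<^sup>2) * 0"
    using LIMSEQ_inverse_real_of_nat unfolding inverse_eq_divide by (rule tendsto_mult_left)
  then have "(\<lambda>m. exp (x\<^sup>2) * (1 / real (Suc m))) \<longlonglongrightarrow> 0"
    by (simp only: mult_zero_right)
  from Lim_null_comparison[OF always_eventually[OF allI[OF bound]] this]
  show ?thesis by (rule LIM_zero_cancel)
qed

text \<open>
  For order \<open>n + 1\<close> the first \<open>n + 1\<close> terms involve negative powers of
  \<open>B\<close> with factorial growth, and among them the one with \<open>i = 0\<close>
  dominates by a factor \<open>n\<close>. The remaining terms are bounded uniformly in
  \<open>n\<close>, hence negligible.
\<close>

lemma hankel_coeff_asymp: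
  assumes "B > 0"
  shows "(\<lambda>n. hankel_coeff (Suc n) (of_real B) * ((-1) ^ n * of_real B ^ Suc n / fact n)) \<longlonglongrightarrow> 1"
proof -
  let ?x = "complex_of_real B"
  define c where "c = norm (Ln ?x - \<i> * of_real pi / 2 + euler_mascheroni)"
  define K where "K = 2 * (c + 1) * exp (2 * B)"
  have K: "K \<ge> 0" by (simp add: K_def c_def)
  let ?h = "\<lambda>n. hankel_coeff (Suc n) ?x * ((-1) ^ n * ?x ^ Suc n / fact n)"
  define \<epsilon> where "\<epsilon> = (\<lambda>n. exp (B\<^sup>2) * (1 / real n) + K * exp (2 * B) * (B * (B ^ n / fact n)))"
  have bound: "norm (?h n - 1) \<le> \<epsilon> n" for n
  proof (rule suminf_near_1)
    let ?t = "\<lambda>i. (-1) ^ i * (lpow (int i - int (Suc n)) ?x * dpow (int i) ?x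
        + dpow (int i - int (Suc n)) ?x * lpow (int i) ?x)"
    let ?f = "(-1) ^ n * ?x ^ Suc n / fact n"
    let ?E = "(\<lambda>y i. y ^ i / fact i) :: real \<Rightarrow> nat \<Rightarrow> real"
    have "?t sums hankel_coeff (Suc n) ?x"
      unfolding hankel_coeff_def by (rule summable_sums[OF summable_norm_cancel[OF summable_hankel_coeff]])
    then show "(\<lambda>i. ?t i * ?f) sums ?h n" by (rule sums_mult2)
    have E: "?E y sums exp y" for y
      using summable_sums[OF summable_power_div_fact[of y]] unfolding suminf_power_div_fact .
    show "(\<lambda>i. ?E (B\<^sup>2) i * (1 / real n) + K * ?E (2 * B) i * (B * ?E B n)) sums \<epsilon> n"
      unfolding \<epsilon>_def by (intro sums_add sums_mult sums_mult2 E)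
    fix i
    have pos: "0 \<le> ?E (B\<^sup>2) i * (1 / real n)" "0 \<le> K * ?E (2 * B) i * (B * ?E B n)"
      using assms K by auto
    show "norm (?t i * ?f - (if i = 0 then 1 else 0)) \<le> ?E (B\<^sup>2) i * (1 / real n) + K * ?E (2 * B) i * (B * ?E B n)"
    proof (cases "i \<le> n")
      case True
      then have e: "int i - int (Suc n) = - int (Suc (n - i))" by simp
      have s: "(-1 :: complex) ^ n = (-1) ^ i * (-1) ^ (n - i)" and b: "?x ^ n = ?x ^ i * ?x ^ (n - i)"
        using True by (simp_all flip: power_add)
      have s1: "(-1) ^ p * ((-1) ^ p * y) = (y :: complex)" for p y
        by (simp flip: mult.assoc power_mult_distrib)
      have "?t i * ?f = (-1) ^ i * ((-1) ^ (n - i) * fact (n - i) / ?x ^ Suc (n - i) * (?x ^ i / fact i)) * ?f"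
        unfolding e lpow_neg dpow_of_nat by (simp add: dpow_def)
      also have "\<dots> = (-1) ^ i * ((-1) ^ i * ((-1) ^ (n - i) * ((-1) ^ (n - i) *
          (fact (n - i) / fact n * (?x ^ i * ?x ^ i / fact i)))))"
        using assms by (simp add: s b field_simps)
      also have "\<dots> = of_real (fact (n - i) / fact n * ?E (B\<^sup>2) i)"
        unfolding s1 by (simp add: power2_eq_square power_mult_distrib)
      finally have t: "?t i * ?f = of_real (fact (n - i) / fact n * ?E (B\<^sup>2) i)" .
      show ?thesis
      proof (cases "i = 0")
        case True
        then show ?thesis unfolding t using pos by simp
      next
        case False
        then have "fact (n - i) / fact n * ?E (B\<^sup>2) i \<le> 1 / real n * ?E (B\<^sup>2) i"
          using True by (intro mult_right_mono fact_ratio_le) auto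
        moreover have "norm (?t i * ?f) = fact (n - i) / fact n * ?E (B\<^sup>2) i"
          unfolding t norm_of_real by simp
        ultimately show ?thesis using False pos by (simp add: mult.commute)
      qed
    next
      case False
      have "norm (?t i) \<le> K * ?E (2 * B) i"
        using hankel_coeff_term_bound[of ?x c B "Suc n" i] False assms unfolding K_def c_def by simp
      moreover have "norm ?f = B * ?E B n"
        using assms by (simp add: norm_mult norm_divide norm_power)
      ultimately have "norm (?t i * ?f) \<le> K * ?E (2 * B) i * (B * ?E B n)"
        unfolding norm_mult[of "?t i"] using assms by (simp only:) (intro mult_right_mono, auto)
      moreover have "norm (?t i * ?f - (if i = 0 then 1 else 0)) = norm (?t i * ?f)"
        using False by simp
      ultimately show ?thesis using pos(1) by linarith
    qed
  qed
  have "\<epsilon> \<longlonglongrightarrow> exp (B\<^sup>2) * 0 + K * exp (2 * B) * (B * 0)"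
    unfolding \<epsilon>_def
    by (intro tendsto_intros lim_1_over_n summable_LIMSEQ_zero[OF summable_power_div_fact])
  then have "\<epsilon> \<longlonglongrightarrow> 0" by (simp only: mult_zero_right add_0_left)
  from Lim_null_comparison[OF always_eventually[OF allI[OF bound]] this]
  show ?thesis by (rule LIM_zero_cancel)
qed

text \<open>
  A discrete Wronskian argument. The Casoratian of the two solutions \<open>hankel_coeff\<close>
  and \<open>bessel_coeff\<close> of the same recurrence does not depend on the order. If
  \<open>hankel_coeff\<close> vanished at one order, so would \<open>bessel_coeff\<close>, hence
  the Casoratian would be zero; but by the asymptotics in the order it tends to
  \<open>1/B\<close>.
\<close>

lemma hankel_coeff_nonzero:
  assumes "B > 0"
  shows "hankel_coeff M (of_real B) \<noteq> 0"
proof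
  let ?x = "complex_of_real B"
  let ?h = "\<lambda>m. hankel_coeff m ?x" and ?j = "\<lambda>m. bessel_coeff m ?x"
  assume h0: "?h M = 0"
  then have j0: "?j M = 0" by (rule bessel_coeff_eq_0_if_hankel_coeff_eq_0[OF assms])
  define W where "W = (\<lambda>m. ?h (Suc m) * ?j m - ?h m * ?j (Suc m))"
  have x0: "?x \<noteq> 0" using assms by simp
  have W_Suc: "W (Suc m) = W m" for m
  proof -
    have "?x * W (Suc m) = (?x * (?h m + ?h (Suc (Suc m)))) * ?j (Suc m) - ?h (Suc m) * (?x * (?j m + ?j (Suc (Suc m))))
        + ?x * (?h (Suc m) * ?j m - ?h m * ?j (Suc m))"
      by (simp add: W_def algebra_simps)
    also have "\<dots> = ?x * W m"
      unfolding hankel_coeff_rec[OF x0] bessel_coeff_rec W_def by (simp add: algebra_simps)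
    finally show ?thesis using x0 by simp
  qed
  have W_const: "W m = W 0" for m by (induction m) (auto simp: W_Suc)
  have W0: "W m = 0" for m using W_const[of M] W_const[of m] h0 j0 by (simp add: W_def)
  \<comment> \<open>The factors that normalise \<open>H\<close> and \<open>J\<close> cancel in \<open>h\<^sub>n\<^sub>+\<^sub>2 j\<^sub>n\<^sub>+\<^sub>1\<close> up to \<open>1/B\<close>, and in \<open>h\<^sub>n\<^sub>+\<^sub>1 j\<^sub>n\<^sub>+\<^sub>2\<close> up to \<open>B/((n+1)(n+2))\<close>.\<close>
  define H where "H = (\<lambda>n. ?h (Suc n) * ((-1) ^ n * ?x ^ Suc n / fact n))"
  define J where "J = (\<lambda>m. complex_of_real (bessel_J (int m) (2 * B) * fact m / B ^ m))"
  have H: "H \<longlonglongrightarrow> 1" unfolding H_def by (rule hankel_coeff_asymp[OF assms])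
  have "J \<longlonglongrightarrow> of_real 1" unfolding J_def by (rule tendsto_of_real[OF bessel_J_asymp[OF assms]])
  then have J: "J \<longlonglongrightarrow> 1" by (simp only: of_real_1)
  have hH: "?h (Suc n) = H n * ((-1) ^ n * fact n / ?x ^ Suc n)" for n
  proof -
    have "(-1) ^ n * ((-1) ^ n * y) = (y :: complex)" for y
      by (simp flip: mult.assoc power_mult_distrib)
    then have "((-1) ^ n * ?x ^ Suc n / fact n) * ((-1) ^ n * fact n / ?x ^ Suc n) = 1"
      using x0 by (simp add: field_simps)
    then show ?thesis unfolding H_def by (simp only: mult.assoc mult_1_right)
  qed
  have jJ: "?j m = J m * ((-1) ^ m * ?x ^ m / fact m)" for m
    using x0 assms by (simp add: bessel_coeff_eq J_def)
  have W_eq: "W (Suc n) = H (Suc n) * J (Suc n) / ?x - H n * J (Suc (Suc n)) * (?x * (1 / (of_nat (Suc n) * of_nat (Suc (Suc n)))))" for n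
  proof -
    have s1: "(-1) ^ p * ((-1) ^ p * y) = (y :: complex)" for p y
      by (simp flip: mult.assoc power_mult_distrib)
    have r: "(Hn * (S * F / X)) * (Jm * (S' * Y / G)) = S * (S' * (Hn * Jm * (F / X * (Y / G))))"
      for Hn Jm S S' F X Y G :: complex by simp
    have "?h (Suc (Suc n)) * ?j (Suc n) = (-1) ^ Suc n * ((-1) ^ Suc n * (H (Suc n) * J (Suc n) * (fact (Suc n) / ?x ^ Suc (Suc n) * (?x ^ Suc n / fact (Suc n)))))"
      unfolding hH[of "Suc n"] jJ by (rule r)
    also have "fact (Suc n) / ?x ^ Suc (Suc n) * (?x ^ Suc n / fact (Suc n)) = 1 / ?x"
      using x0 by (simp del: fact_Suc)
    finally have 1: "?h (Suc (Suc n)) * ?j (Suc n) = H (Suc n) * J (Suc n) / ?x"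
      unfolding s1 by simp
    have "?h (Suc n) * ?j (Suc (Suc n)) = (-1) ^ n * ((-1) ^ n * (H n * J (Suc (Suc n)) * (fact n / ?x ^ Suc n * (?x ^ Suc (Suc n) / fact (Suc (Suc n))))))"
      unfolding hH[of n] jJ r by simp
    also have "fact n / ?x ^ Suc n * (?x ^ Suc (Suc n) / fact (Suc (Suc n))) = ?x * (1 / (of_nat (Suc n) * of_nat (Suc (Suc n))))"
      using x0 by (simp del: of_nat_Suc)
    finally have 2: "?h (Suc n) * ?j (Suc (Suc n)) = H n * J (Suc (Suc n)) * (?x * (1 / (of_nat (Suc n) * of_nat (Suc (Suc n)))))"
      unfolding s1 .
    show ?thesis unfolding W_def 1 2 ..
  qed
  have z: "(\<lambda>n. 1 / (of_nat (Suc n) * of_nat (Suc (Suc n))) :: complex) \<longlonglongrightarrow> 0"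
  proof -
    have "(\<lambda>n. inverse (complex_of_nat (Suc n))) \<longlonglongrightarrow> 0"
      using lim_inverse_n[where ?'a = complex] by (rule LIMSEQ_Suc)
    from tendsto_mult[OF this LIMSEQ_Suc[OF this]] show ?thesis
      by (simp add: field_simps del: of_nat_Suc)
  qed
  have "(\<lambda>n. W (Suc n)) \<longlonglongrightarrow> 1 * 1 / ?x - 1 * 1 * (?x * 0)"
    unfolding W_eq using x0
    by (intro tendsto_diff tendsto_divide tendsto_mult LIMSEQ_Suc[OF LIMSEQ_Suc[OF J]] LIMSEQ_Suc[OF J]
        LIMSEQ_Suc[OF H] H z tendsto_const)
  then have "1 / ?x = 0" using W0 by (simp add: LIMSEQ_const_iff)
  then show False using x0 by simp
qed

lemma positive_sequence_bounds:
  fixes q :: "nat \<Rightarrow> real"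
  assumes "q \<longlonglongrightarrow> L" "L > 0" "\<And>n. q n > 0"
  shows "\<exists>c>0. \<exists>C>0. \<forall>n. c \<le> q n \<and> q n \<le> C"
proof -
  have "Bseq q" using assms(1) by (intro convergent_imp_Bseq) (auto simp: convergent_def)
  then obtain C where C: "C > 0" "\<And>n. norm (q n) \<le> C" by (auto simp: Bseq_def)
  have "(\<lambda>n. inverse (q n)) \<longlonglongrightarrow> inverse L" using assms(1,2) by (intro tendsto_inverse) auto
  then have "Bseq (\<lambda>n. inverse (q n))" by (intro convergent_imp_Bseq) (auto simp: convergent_def)
  then obtain D where D: "D > 0" "\<And>n. norm (inverse (q n)) \<le> D" by (auto simp: Bseq_def)
  have "inverse D \<le> q n" for n
    using D(2)[of n] assms(3)[of n] D(1) by (simp add: field_simps)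
  moreover have "q n \<le> C" for n using C(2)[of n] by simp
  ultimately show ?thesis using C D by (intro exI[of _ "inverse D"] conjI exI[of _ C]) auto
qed

text \<open>
  The quotients of \<open>\<bar>s\<^sub>n\<bar>\<close> by
  \<open>R\<^bsup>-n\<^esup>/(n+1)\<close> are positive and converge to \<open>1/\<pi>\<close>, so
  they stay between two positive constants.
\<close>

lemma mfs_kernel_coeffs:
  assumes k: "k > 0" and J: "\<forall>m::int. bessel_J m k \<noteq> 0" and R: "R > 1"
  shows "\<exists>(s :: nat \<Rightarrow> complex) c C. c > 0 \<and> C > 0
    \<and> (\<forall>n. c \<le> cmod (s n) * real (Suc n) * R ^ n \<and> cmod (s n) * real (Suc n) * R ^ n \<le> C)
    \<and> (\<forall>\<phi>. continuous_on (sphere 0 1) (\<lambda>z. hankel1_0 (k * cmod (z - of_real R * cis \<phi>))))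
    \<and> (\<forall>\<phi> m. fourier_coeff (\<lambda>z. hankel1_0 (k * cmod (z - of_real R * cis \<phi>))) m
          = s (nat \<bar>m\<bar>) * cis (- (of_int m * \<phi>)))"
proof -
  define A B where "A = k / 2" and "B = k * R / 2"
  have AB: "0 < A" "A < B" "0 < B" using k R by (auto simp: A_def B_def)
  have RBA: "R = B / A" using k by (simp add: A_def B_def)
  define s where "s = (\<lambda>m. \<i> / of_real pi * (-1) ^ m * of_real (bessel_J (int m) (2 * A)) * hankel_coeff m (of_real B))"
  let ?K = "\<lambda>\<phi> z. hankel1_0 (k * cmod (z - of_real R * cis \<phi>))"
  have K: "?K \<phi> z = hankel1_0 (2 * cmod (of_real B + - (of_real A * cis (- \<phi>)) * z))" for \<phi> z
  proof -
    have "of_real B + - (of_real A * cis (- \<phi>)) * z = - (of_real (k / 2) * cis (- \<phi>)) * (z - of_real R * cis \<phi>)"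
    proof -
      have "- (P * E) * (z - r * F) = P * r * (E * F) - P * E * z" for P E r F :: complex
        by (simp add: algebra_simps)
      from this[of "of_real (k / 2)" "cis (- \<phi>)" "of_real R" "cis \<phi>"]
      show ?thesis by (simp add: A_def B_def cis_mult)
    qed
    then have "2 * cmod (of_real B + - (of_real A * cis (- \<phi>)) * z) = k * cmod (z - of_real R * cis \<phi>)"
      using k by (simp add: norm_mult del: mult_minus_left)
    then show ?thesis by simp
  qed
  have cont: "continuous_on (sphere 0 1) (?K \<phi>)" for \<phi>
    unfolding K by (rule kernel_fourier(1)) (use AB in auto)
  have coeff_nat: "fourier_coeff (?K \<phi>) (int n) = s n * cis (- (of_int (int n) * \<phi>))" for \<phi> n
  proof -
    have "fourier_coeff (?K \<phi>) (int n) = s n * cis (- \<phi>) ^ n"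
      unfolding K s_def by (rule kernel_fourier(2)) (use AB in auto)
    moreover have "cis (- \<phi>) ^ n = cis (- (of_int (int n) * \<phi>))"
      using cis_power_int[of "- \<phi>" "int n"] by simp
    ultimately show ?thesis by simp
  qed
  have coeff: "fourier_coeff (?K \<phi>) m = s (nat \<bar>m\<bar>) * cis (- (of_int m * \<phi>))" for \<phi> m
  proof (cases m)
    case (nonneg n)
    then show ?thesis using coeff_nat[of \<phi> n] by simp
  next
    case (neg n)
    have "?K \<phi> (cnj z) = ?K (- \<phi>) z" for z
    proof -
      have "cnj (cnj z - of_real R * cis \<phi>) = z - of_real R * cis (- \<phi>)" by (simp add: cis_cnj)
      then show ?thesis by (metis complex_mod_cnj)
    qed
    then have "fourier_coeff (?K (- \<phi>)) (int (Suc n)) = fourier_coeff (?K \<phi>) (- int (Suc n))"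
      using fourier_coeff_cnj_arg[of "?K \<phi>" "int (Suc n)"] by simp
    moreover have "nat \<bar>- int (Suc n)\<bar> = Suc n"
      "- (of_int (- int (Suc n)) * \<phi>) = - (of_int (int (Suc n)) * - \<phi>)"
      by (simp_all add: algebra_simps)
    ultimately show ?thesis unfolding neg using coeff_nat[of "- \<phi>" "Suc n"] by (simp only:)
  qed
  define q where "q = (\<lambda>n. cmod (s n) * real (Suc n) * R ^ n)"
  have "q n > 0" for n
    using J AB R hankel_coeff_nonzero[of B n] k by (simp add: q_def s_def norm_mult A_def)
  moreover have "q \<longlonglongrightarrow> 1 / pi"
  proof (rule LIMSEQ_imp_Suc)
    let ?X = "\<lambda>m. bessel_J (int m) (2 * A) * fact m / A ^ m"
    let ?H = "\<lambda>n. hankel_coeff (Suc n) (of_real B) * ((-1) ^ n * of_real B ^ Suc n / fact n)"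
    have "q (Suc n) = 1 / pi * (\<bar>?X (Suc n)\<bar> * cmod (?H n) * (real (Suc (Suc n)) / real (Suc n)))" for n
      using AB by (simp add: q_def s_def RBA norm_mult norm_divide norm_power abs_mult field_simps del: of_nat_Suc)
    moreover have "(\<lambda>n. real (Suc (Suc n)) / real (Suc n)) \<longlonglongrightarrow> 1"
      by (rule LIMSEQ_Suc[OF LIMSEQ_Suc_n_over_n])
    then have "(\<lambda>n. 1 / pi * (\<bar>?X (Suc n)\<bar> * cmod (?H n) * (real (Suc (Suc n)) / real (Suc n))))
        \<longlonglongrightarrow> 1 / pi * (\<bar>1\<bar> * cmod 1 * 1)"
      by (intro tendsto_mult tendsto_const tendsto_rabs tendsto_norm hankel_coeff_asymp
            LIMSEQ_Suc[OF bessel_J_asymp] AB)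
    ultimately show "(\<lambda>n. q (Suc n)) \<longlonglongrightarrow> 1 / pi" by simp
  qed
  ultimately obtain c C where "c > 0" "C > 0" "\<forall>n. c \<le> q n \<and> q n \<le> C"
    using positive_sequence_bounds[of q "1 / pi"] by auto
  with cont coeff show ?thesis unfolding q_def by blast
qed

section \<open>Equally spaced charges and aliasing\<close>

lemma root_of_unity_sum:
  assumes "N > 0"
  shows "(\<Sum>j = 1..N. cis (of_int d * (2 * pi * real j / real N))) = (if int N dvd d then of_nat N else 0)"
proof -
  define \<omega> where "\<omega> = cis (2 * pi * of_int d / real N)"
  have pow: "cis (of_int d * (2 * pi * real j / real N)) = \<omega> ^ j" for j
    unfolding \<omega>_def Complex.DeMoivre by (rule arg_cong[where f = cis]) simp
  have one: "\<omega> = 1 \<longleftrightarrow> int N dvd d"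
  proof
    assume "\<omega> = 1"
    then obtain n where "2 * pi * of_int d / real N = of_int n * (2 * pi)"
      unfolding \<omega>_def cis_eq_1_iff by blast
    then have "real_of_int d = real_of_int (int N * n)" using assms by (simp add: field_simps)
    then have "d = int N * n" by (simp only: of_int_eq_iff)
    then show "int N dvd d" by simp
  next
    assume "int N dvd d"
    then obtain n where "d = int N * n" by blast
    then have "2 * pi * of_int d / real N = of_int n * (2 * pi)" using assms by simp
    then show "\<omega> = 1" unfolding \<omega>_def cis_eq_1_iff by blast
  qed
  have "\<omega> ^ N = 1"
    using pow[of N] assms cis_multiple_2pi[of "of_int d"] by (simp add: mult.commute)
  have shift: "(\<Sum>j = 1..N. \<omega> ^ j) = \<omega> * (\<Sum>j<N. \<omega> ^ j)"
    unfolding sum_distrib_left power_Suc[symmetric]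
    by (rule sum.reindex_bij_witness[of _ Suc "\<lambda>j. j - 1"]) auto
  show ?thesis
  proof (cases "int N dvd d")
    case True
    then show ?thesis unfolding pow using one by simp
  next
    case False
    then have "(\<Sum>j<N. \<omega> ^ j) = 0" using one \<open>\<omega> ^ N = 1\<close> by (simp add: sum_gp_strict)
    then show ?thesis unfolding pow shift using False by simp
  qed
qed

text \<open>
  The representative of \<open>m\<close> modulo \<open>2M\<close> of least absolute value, with
  \<open>M\<close> preferred to \<open>-M\<close>. It never exceeds \<open>m\<close> in absolute
  value, which keeps the alias factors \<open>s\<^sub>m/s\<^sub>r\<close> small.
\<close>

definition balanced_residue :: "nat \<Rightarrow> int \<Rightarrow> int" where
  "balanced_residue M m = (m + int M - 1) mod (2 * int M) - int M + 1"

definition balanced_quotient :: "nat \<Rightarrow> int \<Rightarrow> int" where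
  "balanced_quotient M m = (m + int M - 1) div (2 * int M)"

lemma balanced_decomposition:
  "m = balanced_residue M m + 2 * int M * balanced_quotient M m"
  unfolding balanced_residue_def balanced_quotient_def
  using mult_div_mod_eq[of "2 * int M" "m + int M - 1"] by linarith

lemma balanced_residue_range:
  fixes M :: nat
  assumes "M > 0"
  shows "balanced_residue M m \<in> {- int M<..int M}"
proof -
  have "2 * int M > 0" using assms by simp
  from pos_mod_bound[OF this, of "m + int M - 1"] pos_mod_sign[OF this, of "m + int M - 1"]
  show ?thesis unfolding balanced_residue_def greaterThanAtMost_iff by linarith
qed

lemma balanced_residue_unique:
  fixes M :: nat
  assumes "M > 0" "r \<in> {- int M<..int M}"
  shows "2 * int M dvd r - m \<longleftrightarrow> r = balanced_residue M m"
proof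
  assume "2 * int M dvd r - m"
  then have "(r + int M - 1) mod (2 * int M) = (m + int M - 1) mod (2 * int M)"
    by (simp add: mod_eq_dvd_iff)
  moreover have "(r + int M - 1) mod (2 * int M) = r + int M - 1"
    using assms by (intro mod_pos_pos_trivial) auto
  ultimately show "r = balanced_residue M m" unfolding balanced_residue_def by linarith
next
  assume "r = balanced_residue M m"
  then have "r - m = 2 * int M * (- balanced_quotient M m)"
    using balanced_decomposition[of m M] by simp
  then show "2 * int M dvd r - m" by (metis dvd_triv_left)
qed

lemma discrete_fourier_inversion:
  fixes M :: nat and \<beta> :: "int \<Rightarrow> complex"
  assumes "M > 0"
  shows "\<exists>\<alpha>. \<forall>m. (\<Sum>j = 1..2 * M. \<alpha> j * cis (- (of_int m * (2 * pi * real j / real (2 * M)))))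
    = \<beta> (balanced_residue M m)"
proof -
  define \<phi> where "\<phi> = (\<lambda>j. 2 * pi * real j / real (2 * M))"
  define \<alpha> where "\<alpha> = (\<lambda>j. (\<Sum>r\<in>{- int M<..int M}. \<beta> r * cis (of_int r * \<phi> j)) / of_nat (2 * M))"
  have "(\<Sum>j = 1..2 * M. \<alpha> j * cis (- (of_int m * \<phi> j))) = \<beta> (balanced_residue M m)" for m
  proof -
    have "(\<Sum>j = 1..2 * M. \<alpha> j * cis (- (of_int m * \<phi> j)))
      = (\<Sum>j = 1..2 * M. \<Sum>r\<in>{- int M<..int M}. \<beta> r / of_nat (2 * M) * cis (of_int (r - m) * \<phi> j))"
      unfolding \<alpha>_def sum_divide_distrib sum_distrib_right
    proof (intro sum.cong refl)
      fix j r
      have "cis (of_int r * \<phi> j) * cis (- (of_int m * \<phi> j)) = cis (of_int (r - m) * \<phi> j)"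
        unfolding cis_mult by (simp add: algebra_simps)
      then show "\<beta> r * cis (of_int r * \<phi> j) / of_nat (2 * M) * cis (- (of_int m * \<phi> j))
          = \<beta> r / of_nat (2 * M) * cis (of_int (r - m) * \<phi> j)"
        by (simp add: mult.assoc)
    qed
    also have "\<dots> = (\<Sum>r\<in>{- int M<..int M}. \<beta> r / of_nat (2 * M) * (\<Sum>j = 1..2 * M. cis (of_int (r - m) * \<phi> j)))"
      by (subst sum.swap) (simp add: sum_distrib_left)
    also have "\<dots> = (\<Sum>r\<in>{- int M<..int M}. if r = balanced_residue M m then \<beta> r else 0)"
    proof (rule sum.cong)
      fix r assume r: "r \<in> {- int M<..int M}"
      have "(\<Sum>j = 1..2 * M. cis (of_int (r - m) * \<phi> j))
          = (if r = balanced_residue M m then of_nat (2 * M) else 0)"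
        unfolding \<phi>_def using root_of_unity_sum[of "2 * M" "r - m"] balanced_residue_unique[OF assms r, of m] assms
        by simp
      then show "\<beta> r / of_nat (2 * M) * (\<Sum>j = 1..2 * M. cis (of_int (r - m) * \<phi> j))
          = (if r = balanced_residue M m then \<beta> r else 0)"
        using assms by simp
    qed simp
    also have "\<dots> = \<beta> (balanced_residue M m)"
      using balanced_residue_range[OF assms, of m] by simp
    finally show ?thesis .
  qed
  then show ?thesis unfolding \<phi>_def by blast
qed

text \<open>
  Each absolute value is taken by at most two integers.
\<close>

lemma sum_nat_abs_le:
  fixes f :: "nat \<Rightarrow> real"
  assumes "finite F" "\<And>n. f n \<ge> 0"
  shows "(\<Sum>m\<in>F. f (nat \<bar>m\<bar>)) \<le> 2 * (\<Sum>n\<in>(\<lambda>m. nat \<bar>m\<bar>) ` F. f n)"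
proof -
  define G where "G = (\<lambda>m. nat \<bar>m\<bar>) ` F"
  have G: "finite G" using assms by (simp add: G_def)
  have "F \<subseteq> int ` G \<union> (\<lambda>n. - int n) ` G"
  proof
    fix m assume "m \<in> F"
    then have "nat \<bar>m\<bar> \<in> G" by (simp add: G_def)
    moreover have "m = int (nat \<bar>m\<bar>) \<or> m = - int (nat \<bar>m\<bar>)" by auto
    ultimately show "m \<in> int ` G \<union> (\<lambda>n. - int n) ` G" by blast
  qed
  then have "(\<Sum>m\<in>F. f (nat \<bar>m\<bar>)) \<le> (\<Sum>m\<in>int ` G \<union> (\<lambda>n. - int n) ` G. f (nat \<bar>m\<bar>))"
    using G assms by (intro sum_mono2) auto
  also have "\<dots> \<le> (\<Sum>m\<in>int ` G. f (nat \<bar>m\<bar>)) + (\<Sum>m\<in>(\<lambda>n. - int n) ` G. f (nat \<bar>m\<bar>))"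
  proof -
    have "(\<Sum>m\<in>int ` G \<inter> (\<lambda>n. - int n) ` G. f (nat \<bar>m\<bar>)) \<ge> 0"
      by (intro sum_nonneg assms)
    then show ?thesis
      using sum_Un[of "int ` G" "(\<lambda>n. - int n) ` G" "\<lambda>m. f (nat \<bar>m\<bar>)"] G by auto
  qed
  also have "\<dots> = 2 * (\<Sum>n\<in>G. f n)"
    by (simp add: sum.reindex inj_on_def)
  finally show ?thesis by (simp add: G_def)
qed

lemma geometric_tail_le:
  fixes q :: real
  assumes "finite G" "G \<subseteq> {M..}" "0 \<le> q" "q < 1"
  shows "(\<Sum>n\<in>G. q ^ n) \<le> q ^ M / (1 - q)"
proof -
  have "(\<lambda>n. q ^ M * q ^ n) sums (q ^ M * (1 / (1 - q)))"
    using assms by (intro sums_mult geometric_sums) simp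
  have "(\<Sum>n\<in>G. q ^ n) = (\<Sum>n\<in>(\<lambda>n. n - M) ` G. q ^ M * q ^ n)"
    using assms(2)
    by (subst sum.reindex) (auto simp: inj_on_def eq_diff_iff subset_iff simp flip: power_add intro!: sum.cong)
  also have "\<dots> \<le> q ^ M * (1 / (1 - q))"
    using sum_le_suminf[of "\<lambda>n. q ^ M * q ^ n" "(\<lambda>n. n - M) ` G"] assms
      \<open>(\<lambda>n. q ^ M * q ^ n) sums _\<close> by (simp add: sums_iff)
  finally show ?thesis by simp
qed

lemma min_boundary_error_le:
  assumes v: "continuous_on (sphere 0 1) v"
    and g: "\<And>j. continuous_on (sphere 0 1) (\<lambda>x. hankel1_0 (k * cmod (x - charge_point R N j)))"
  shows "min_boundary_error k R v N \<le> boundary_error k R v N \<alpha>"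
    and "0 \<le> min_boundary_error k R v N"
proof -
  define u where "u = (\<lambda>j x. \<i> / 4 * hankel1_0 (k * cmod (x - charge_point R N j)))"
  have u: "continuous_on (sphere 0 1) (u j)" for j
    unfolding u_def by (intro continuous_intros g)
  have err: "boundary_error k R v N \<alpha> = sqrt (circle_energy (\<lambda>z. (\<Sum>j = 1..N. \<alpha> j * u j z) - v z))" for \<alpha>
    unfolding boundary_error_def L2_norm_circle_conv_energy mfs_def u_def
    by (simp add: sum_distrib_left mult_ac)
  obtain \<alpha>\<^sub>0 where "\<forall>\<beta>. circle_energy (\<lambda>z. (\<Sum>j = 1..N. \<alpha>\<^sub>0 j * u j z) - v z)
      \<le> circle_energy (\<lambda>z. (\<Sum>j = 1..N. \<beta> j * u j z) - v z)"
    using least_squares_attained[of "{1..N}" u v] u v by blast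
  then have "boundary_error k R v N \<alpha>\<^sub>0 \<le> boundary_error k R v N \<beta>" for \<beta>
    unfolding err by simp
  moreover from this have "min_boundary_error k R v N = boundary_error k R v N \<alpha>\<^sub>0"
    unfolding min_boundary_error_def by (intro Least_equality) auto
  ultimately show "min_boundary_error k R v N \<le> boundary_error k R v N \<alpha>"
    "0 \<le> min_boundary_error k R v N"
    by (simp_all add: err circle_energy_nonneg)
qed

lemma power2_sum_le: "(a + b)\<^sup>2 \<le> 2 * a\<^sup>2 + 2 * (b::real)\<^sup>2"
  using sum_squares_bound[of a b] by (simp add: power2_sum)

text \<open>
  Here \<open>a\<close> and \<open>e\<close> are the absolute values of a frequency
  \<open>r\<close> and of an alias \<open>m = r \<plusminus> lN\<close>. Replacing
  \<open>e\<close> by \<open>Nl - a\<close> decouples \<open>r\<close> from \<open>l\<close>, so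
  that the double sum over the aliases factorises.
\<close>

lemma aliasing_term_bound:
  fixes R \<rho> :: real
  assumes "R > 1" "\<rho> > 0" "N * l \<le> a + e"
  shows "(R ^ a / R ^ e * (1 / \<rho> ^ a))\<^sup>2 \<le> ((R\<^sup>2 / \<rho>)\<^sup>2) ^ a * ((1 / R) ^ (2 * N)) ^ l"
proof -
  have "R ^ (N * l) \<le> R ^ (a + e)" using assms by (intro power_increasing) auto
  then have "R ^ a / R ^ e \<le> R ^ a * R ^ a * (1 / R) ^ (N * l)"
    using assms by (simp add: field_simps power_add)
  then have "R ^ a / R ^ e * (1 / \<rho> ^ a) \<le> R ^ a * R ^ a * (1 / R) ^ (N * l) * (1 / \<rho> ^ a)"
    using assms by (intro mult_right_mono) auto
  then have "(R ^ a / R ^ e * (1 / \<rho> ^ a))\<^sup>2 \<le> (R ^ a * R ^ a * (1 / R) ^ (N * l) * (1 / \<rho> ^ a))\<^sup>2"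
    using assms by (intro power_mono) auto
  also have "R ^ a * R ^ a * (1 / R) ^ (N * l) * (1 / \<rho> ^ a) = (R\<^sup>2 / \<rho>) ^ a * (1 / R) ^ (N * l)"
    by (simp add: power_divide power2_eq_square power_mult_distrib)
  also have "((R\<^sup>2 / \<rho>) ^ a * (1 / R) ^ (N * l))\<^sup>2 = ((R\<^sup>2 / \<rho>)\<^sup>2) ^ a * ((1 / R) ^ (2 * N)) ^ l"
    by (simp add: power_mult_distrib power_mult[symmetric] mult_ac)
  finally show ?thesis .
qed

text \<open>
  The first summand collects the frequencies of the data at or beyond \<open>M\<close>, the second
  one the aliases, where the geometric sum over the blocks \<open>l \<noteq> 0\<close> is
  comparable to its leading term \<open>R\<^bsup>-4M\<^esup>\<close>.
\<close>

lemma mfs_error_bound: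
  fixes k R :: real
  assumes k: "k > 0" and J: "\<forall>m::int. bessel_J m k \<noteq> 0" and R: "R > 1"
  shows "\<exists>K>0. \<forall>v D \<rho> M. continuous_on (sphere 0 1) v \<and> \<rho> > 1 \<and> M > 0
      \<and> (\<forall>m. cmod (fourier_coeff v m) \<le> D / \<rho> ^ nat \<bar>m\<bar>) \<longrightarrow>
     (min_boundary_error k R v (2 * M))\<^sup>2 \<le>
       2 * pi * D\<^sup>2 * (4 / (1 - (1 / \<rho>)\<^sup>2) * ((1 / \<rho>)\<^sup>2) ^ M
         + K * (1 / R) ^ (2 * (2 * M)) * (\<Sum>n\<le>M. ((R\<^sup>2 / \<rho>)\<^sup>2) ^ n))"
proof -
  obtain s c C where c: "c > 0" and C: "C > 0"
    and lo: "\<And>n. c \<le> cmod (s n) * real (Suc n) * R ^ n"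
    and up: "\<And>n. cmod (s n) * real (Suc n) * R ^ n \<le> C"
    and cont: "\<And>\<phi>. continuous_on (sphere 0 1) (\<lambda>z. hankel1_0 (k * cmod (z - of_real R * cis \<phi>)))"
    and coeff: "\<And>\<phi> m. fourier_coeff (\<lambda>z. hankel1_0 (k * cmod (z - of_real R * cis \<phi>))) m
          = s (nat \<bar>m\<bar>) * cis (- (of_int m * \<phi>))"
    using mfs_kernel_coeffs[OF assms] by metis
  have s0: "s n \<noteq> 0" for n using lo[of n] c by auto
  have ratio: "cmod (s e) / cmod (s a) \<le> C / c * (R ^ a / R ^ e)" if "a \<le> e" for a e
  proof -
    have "cmod (s e) * real (Suc a) * R ^ e \<le> cmod (s e) * real (Suc e) * R ^ e"
      using that R by (intro mult_right_mono mult_left_mono) auto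
    also have "\<dots> \<le> C" by (rule up)
    finally have 1: "cmod (s e) * (real (Suc a) * R ^ e) \<le> C" by (simp add: mult.assoc)
    have "cmod (s e) * (real (Suc a) * R ^ e) * c \<le> C * (cmod (s a) * real (Suc a) * R ^ a)"
      using 1 lo[of a] c C R by (intro mult_mono) auto
    then have "(cmod (s e) * R ^ e * c) * real (Suc a) \<le> (C * cmod (s a) * R ^ a) * real (Suc a)"
      by (simp only: mult_ac)
    then have "cmod (s e) * R ^ e * c \<le> C * cmod (s a) * R ^ a"
      by (rule mult_right_le_imp_le) simp
    then show ?thesis using c R s0[of a] by (simp add: field_simps)
  qed
  define K where "K = 8 * (C / c)\<^sup>2 / (1 - 1 / R)"
  have K: "K > 0" using c C R by (simp add: K_def)
  show ?thesis
  proof (intro exI[of _ K] conjI K allI impI)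
    fix v :: "complex \<Rightarrow> complex" and D \<rho> :: real and M :: nat
    assume "continuous_on (sphere 0 1) v \<and> \<rho> > 1 \<and> M > 0
      \<and> (\<forall>m. cmod (fourier_coeff v m) \<le> D / \<rho> ^ nat \<bar>m\<bar>)"
    then have v: "continuous_on (sphere 0 1) v" and \<rho>: "\<rho> > 1" and M: "M > 0"
      and D: "\<And>m. cmod (fourier_coeff v m) \<le> D / \<rho> ^ nat \<bar>m\<bar>" by auto
    define rep where "rep = balanced_residue M"
    define quo where "quo = balanced_quotient M"
    have rep: "rep m \<in> {- int M<..int M}" for m unfolding rep_def by (rule balanced_residue_range[OF M])
    have dec: "m = rep m + 2 * int M * quo m" for m
      unfolding rep_def quo_def by (rule balanced_decomposition)
    \<comment> \<open>The factor \<open>4 / \<i>\<close> undoes the \<open>\<i> / 4\<close> in front of the charges; the frequencies that are balanced residues come out exact.\<close>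
    obtain \<alpha> where \<alpha>: "\<And>m. (\<Sum>j = 1..2 * M. \<alpha> j * cis (- (of_int m * (2 * pi * real j / real (2 * M)))))
        = 4 / \<i> * (fourier_coeff v (rep m) / s (nat \<bar>rep m\<bar>))"
      using discrete_fourier_inversion[OF M, of "\<lambda>r. 4 / \<i> * (fourier_coeff v r / s (nat \<bar>r\<bar>))"]
      unfolding rep_def by blast
    define f where "f = (\<lambda>z. mfs k R (2 * M) \<alpha> z - v z)"
    have contj: "continuous_on (sphere 0 1) (\<lambda>z. hankel1_0 (k * cmod (z - charge_point R (2 * M) j)))" for j
      unfolding charge_point_def by (rule cont)
    have cmfs: "continuous_on (sphere 0 1) (mfs k R (2 * M) \<alpha>)"
      unfolding mfs_def[abs_def] by (intro continuous_intros contj)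
    have fc: "fourier_coeff f m = s (nat \<bar>m\<bar>) / s (nat \<bar>rep m\<bar>) * fourier_coeff v (rep m) - fourier_coeff v m" for m
    proof -
      have "fourier_coeff (mfs k R (2 * M) \<alpha>) m
          = \<i> / 4 * (\<Sum>j = 1..2 * M. \<alpha> j * (s (nat \<bar>m\<bar>) * cis (- (of_int m * (2 * pi * real j / real (2 * M))))))"
        unfolding mfs_def[abs_def] fourier_coeff_cmult
        by (subst fourier_coeff_sum, intro continuous_on_mult continuous_on_const contj)
           (simp only: fourier_coeff_cmult charge_point_def coeff)
      also have "\<dots> = \<i> / 4 * s (nat \<bar>m\<bar>) * (\<Sum>j = 1..2 * M. \<alpha> j * cis (- (of_int m * (2 * pi * real j / real (2 * M)))))"
        unfolding sum_distrib_left by (simp only: mult_ac)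
      also have "\<dots> = s (nat \<bar>m\<bar>) / s (nat \<bar>rep m\<bar>) * fourier_coeff v (rep m)"
      proof -
        have "\<i> / 4 * a * (4 / \<i> * (b / c)) = a / c * b" for a b c :: complex
        proof -
          have "\<i> / 4 * a * (4 / \<i> * (b / c)) = (\<i> / 4 * (4 / \<i>)) * (a * (b / c))"
            by (simp only: mult_ac)
          also have "\<i> / 4 * (4 / \<i>) = 1" by simp
          finally show ?thesis by simp
        qed
        then show ?thesis unfolding \<alpha> .
      qed
      finally show ?thesis unfolding f_def fourier_coeff_diff[OF cmfs v] by simp
    qed
    define x where "x = (R\<^sup>2 / \<rho>)\<^sup>2"
    define Q where "Q = (1 / R) ^ (2 * (2 * M))"
    define p where "p = (1 / \<rho>)\<^sup>2"
    have x: "x \<ge> 0" by (simp add: x_def)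
    have Q: "0 \<le> Q" "Q \<le> 1 / R"
    proof -
      have "(1 / R) ^ (2 * (2 * M)) \<le> (1 / R) ^ 1" using R M by (intro power_decreasing) auto
      then show "Q \<le> 1 / R" by (simp add: Q_def)
    qed (use R in \<open>simp add: Q_def\<close>)
    have "1 / R < 1" using R by simp
    with Q(2) have Q1: "Q < 1" by linarith
    have p: "0 \<le> p" "p < 1" using \<rho> by (simp_all add: p_def abs_square_less_1)
    let ?g = "\<lambda>m. 2 * D\<^sup>2 * p ^ nat \<bar>m\<bar> + 2 * (C / c)\<^sup>2 * D\<^sup>2 * (x ^ nat \<bar>rep m\<bar> * Q ^ nat \<bar>quo m\<bar>)"
    have big: "\<bar>m\<bar> \<ge> int M" "\<bar>rep m\<bar> \<le> \<bar>m\<bar>" "2 * M * nat \<bar>quo m\<bar> \<le> nat \<bar>rep m\<bar> + nat \<bar>m\<bar>" if "quo m \<noteq> 0" for m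
    proof -
      have "\<bar>2 * int M * quo m\<bar> \<le> \<bar>rep m\<bar> + \<bar>m\<bar>" using dec[of m] by linarith
      then have le: "2 * int M * \<bar>quo m\<bar> \<le> \<bar>rep m\<bar> + \<bar>m\<bar>" by (simp add: abs_mult)
      then have "int (2 * M * nat \<bar>quo m\<bar>) \<le> int (nat \<bar>rep m\<bar> + nat \<bar>m\<bar>)" by simp
      then show "2 * M * nat \<bar>quo m\<bar> \<le> nat \<bar>rep m\<bar> + nat \<bar>m\<bar>" by (simp only: of_nat_le_iff)
      have "2 * int M * 1 \<le> 2 * int M * \<bar>quo m\<bar>" using that by (intro mult_left_mono) auto
      moreover have "\<bar>rep m\<bar> \<le> int M" using rep[of m] by auto
      ultimately show "\<bar>m\<bar> \<ge> int M" "\<bar>rep m\<bar> \<le> \<bar>m\<bar>" using le by linarith+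
    qed
    have term0: "fourier_coeff f m = 0" if "quo m = 0" for m
    proof -
      have "rep m = m" using dec[of m] that by simp
      then show ?thesis unfolding fc using s0 by simp
    qed
    have term1: "(cmod (fourier_coeff f m))\<^sup>2 \<le> ?g m" if "quo m \<noteq> 0" for m
    proof -
      let ?a = "nat \<bar>rep m\<bar>" and ?e = "nat \<bar>m\<bar>"
      have ae: "?a \<le> ?e" using big(2)[OF that] by simp
      have "cmod (fourier_coeff f m) \<le> cmod (s ?e) / cmod (s ?a) * cmod (fourier_coeff v (rep m)) + cmod (fourier_coeff v m)"
        unfolding fc by (rule order_trans[OF norm_triangle_ineq4]) (simp add: norm_mult norm_divide)
      also have "\<dots> \<le> C / c * (R ^ ?a / R ^ ?e) * (D / \<rho> ^ ?a) + D / \<rho> ^ ?e"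
        using ratio[OF ae] D[of "rep m"] D[of m] c C R by (intro add_mono mult_mono) auto
      finally have "(cmod (fourier_coeff f m))\<^sup>2 \<le> (C / c * (R ^ ?a / R ^ ?e) * (D / \<rho> ^ ?a) + D / \<rho> ^ ?e)\<^sup>2"
        by (intro power_mono) auto
      also have "\<dots> \<le> 2 * (C / c * (R ^ ?a / R ^ ?e) * (D / \<rho> ^ ?a))\<^sup>2 + 2 * (D / \<rho> ^ ?e)\<^sup>2"
        by (rule power2_sum_le)
      also have "(D / \<rho> ^ ?e)\<^sup>2 = D\<^sup>2 * p ^ ?e"
        unfolding p_def by (simp add: power_divide power_mult[symmetric] mult.commute)
      also have "(C / c * (R ^ ?a / R ^ ?e) * (D / \<rho> ^ ?a))\<^sup>2 = (C / c)\<^sup>2 * D\<^sup>2 * (R ^ ?a / R ^ ?e * (1 / \<rho> ^ ?a))\<^sup>2"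
        by (simp add: power_mult_distrib power_divide mult_ac)
      also have "\<dots> \<le> (C / c)\<^sup>2 * D\<^sup>2 * (x ^ ?a * Q ^ nat \<bar>quo m\<bar>)"
        unfolding x_def Q_def using R \<rho> big(3)[OF that] by (intro mult_left_mono aliasing_term_bound) auto
      finally show ?thesis by (simp add: mult_ac)
    qed
    have "circle_energy f \<le> 2 * pi * (D\<^sup>2 * (4 / (1 - p) * p ^ M + K * Q * (\<Sum>n\<le>M. x ^ n)))"
    proof (rule circle_energy_le_bessel_bound)
      show "continuous_on (sphere 0 1) f" unfolding f_def by (intro continuous_intros cmfs v)
      fix F :: "int set" assume F: "finite F"
      define F' where "F' = {m \<in> F. quo m \<noteq> 0}"
      have F': "finite F'" using F by (simp add: F'_def)
      have "(\<Sum>m\<in>F. (cmod (fourier_coeff f m))\<^sup>2) = (\<Sum>m\<in>F'. (cmod (fourier_coeff f m))\<^sup>2)"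
        by (rule sum.mono_neutral_right) (use F term0 in \<open>auto simp: F'_def\<close>)
      also have "\<dots> \<le> (\<Sum>m\<in>F'. ?g m)" by (rule sum_mono) (use term1 in \<open>auto simp: F'_def\<close>)
      also have "\<dots> = 2 * D\<^sup>2 * (\<Sum>m\<in>F'. p ^ nat \<bar>m\<bar>)
          + 2 * (C / c)\<^sup>2 * D\<^sup>2 * (\<Sum>m\<in>F'. x ^ nat \<bar>rep m\<bar> * Q ^ nat \<bar>quo m\<bar>)"
        by (simp add: sum.distrib sum_distrib_left)
      also have "(\<Sum>m\<in>F'. p ^ nat \<bar>m\<bar>) \<le> 2 * (p ^ M / (1 - p))"
      proof -
        have "(\<Sum>m\<in>F'. p ^ nat \<bar>m\<bar>) \<le> 2 * (\<Sum>n\<in>(\<lambda>m. nat \<bar>m\<bar>) ` F'. p ^ n)"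
          using p by (intro sum_nat_abs_le F') auto
        also have "(\<Sum>n\<in>(\<lambda>m. nat \<bar>m\<bar>) ` F'. p ^ n) \<le> p ^ M / (1 - p)"
          using p F' big(1) by (intro geometric_tail_le) (auto simp: F'_def le_nat_iff)
        finally show ?thesis by simp
      qed
      also have "(\<Sum>m\<in>F'. x ^ nat \<bar>rep m\<bar> * Q ^ nat \<bar>quo m\<bar>) \<le> (2 * (\<Sum>n\<le>M. x ^ n)) * (2 * (Q / (1 - 1 / R)))"
      proof -
        \<comment> \<open>A frequency is determined by its residue and its block, so the sum is part of a double sum.\<close>
        have inj: "inj_on (\<lambda>m. (rep m, quo m)) F'"
          by (rule inj_onI) (metis dec prod.inject)
        have "(\<Sum>m\<in>F'. x ^ nat \<bar>rep m\<bar> * Q ^ nat \<bar>quo m\<bar>)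
            = (\<Sum>(r, b)\<in>(\<lambda>m. (rep m, quo m)) ` F'. x ^ nat \<bar>r\<bar> * Q ^ nat \<bar>b\<bar>)"
          by (subst sum.reindex[OF inj]) simp
        also have "\<dots> \<le> (\<Sum>(r, b)\<in>{- int M<..int M} \<times> quo ` F'. x ^ nat \<bar>r\<bar> * Q ^ nat \<bar>b\<bar>)"
          using F' rep x Q by (intro sum_mono2) auto
        also have "\<dots> = (\<Sum>r\<in>{- int M<..int M}. x ^ nat \<bar>r\<bar>) * (\<Sum>b\<in>quo ` F'. Q ^ nat \<bar>b\<bar>)"
          by (simp add: sum_product sum.cartesian_product)
        also have "\<dots> \<le> (2 * (\<Sum>n\<le>M. x ^ n)) * (2 * (Q / (1 - 1 / R)))"
        proof (intro mult_mono)
          have "(\<Sum>r\<in>{- int M<..int M}. x ^ nat \<bar>r\<bar>) \<le> 2 * (\<Sum>n\<in>(\<lambda>m. nat \<bar>m\<bar>) ` {- int M<..int M}. x ^ n)"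
            using x by (intro sum_nat_abs_le) auto
          also have "(\<Sum>n\<in>(\<lambda>m. nat \<bar>m\<bar>) ` {- int M<..int M}. x ^ n) \<le> (\<Sum>n\<le>M. x ^ n)"
            using x by (intro sum_mono2) auto
          finally show "(\<Sum>r\<in>{- int M<..int M}. x ^ nat \<bar>r\<bar>) \<le> 2 * (\<Sum>n\<le>M. x ^ n)" by simp
          have "(\<Sum>b\<in>quo ` F'. Q ^ nat \<bar>b\<bar>) \<le> 2 * (\<Sum>n\<in>(\<lambda>m. nat \<bar>m\<bar>) ` quo ` F'. Q ^ n)"
            using Q F' by (intro sum_nat_abs_le) auto
          also have "(\<Sum>n\<in>(\<lambda>m. nat \<bar>m\<bar>) ` quo ` F'. Q ^ n) \<le> Q ^ 1 / (1 - Q)"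
            using Q Q1 F' by (intro geometric_tail_le) (auto simp: F'_def)
          also have "\<dots> \<le> Q / (1 - 1 / R)"
            using Q Q1 R by (simp add: frac_le)
          finally show "(\<Sum>b\<in>quo ` F'. Q ^ nat \<bar>b\<bar>) \<le> 2 * (Q / (1 - 1 / R))" by simp
        qed (use x Q in \<open>auto intro!: sum_nonneg\<close>)
        finally show ?thesis .
      qed
      finally have "(\<Sum>m\<in>F. (cmod (fourier_coeff f m))\<^sup>2) \<le> 2 * D\<^sup>2 * (2 * (p ^ M / (1 - p)))
          + 2 * (C / c)\<^sup>2 * D\<^sup>2 * ((2 * (\<Sum>n\<le>M. x ^ n)) * (2 * (Q / (1 - 1 / R))))"
        by (simp add: mult_left_mono add_mono)
      also have "\<dots> = D\<^sup>2 * (4 / (1 - p) * p ^ M + K * Q * (\<Sum>n\<le>M. x ^ n))"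
        unfolding K_def by (simp add: algebra_simps)
      finally show "(\<Sum>m\<in>F. (cmod (fourier_coeff f m))\<^sup>2) \<le> D\<^sup>2 * (4 / (1 - p) * p ^ M + K * Q * (\<Sum>n\<le>M. x ^ n))" .
    qed
    moreover have "(min_boundary_error k R v (2 * M))\<^sup>2 \<le> circle_energy f"
    proof -
      have "min_boundary_error k R v (2 * M) \<le> sqrt (circle_energy f)"
        using min_boundary_error_le(1)[OF v contj, of \<alpha>]
        unfolding boundary_error_def L2_norm_circle_conv_energy f_def .
      then have "(min_boundary_error k R v (2 * M))\<^sup>2 \<le> (sqrt (circle_energy f))\<^sup>2"
        using min_boundary_error_le(2)[OF v contj] by (rule power_mono)
      then show ?thesis by (simp add: circle_energy_nonneg)
    qed
    ultimately show "(min_boundary_error k R v (2 * M))\<^sup>2 \<le>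
       2 * pi * D\<^sup>2 * (4 / (1 - (1 / \<rho>)\<^sup>2) * ((1 / \<rho>)\<^sup>2) ^ M
         + K * (1 / R) ^ (2 * (2 * M)) * (\<Sum>n\<le>M. ((R\<^sup>2 / \<rho>)\<^sup>2) ^ n))"
      unfolding p_def Q_def x_def by (simp add: mult.assoc)
  qed
qed

section \<open>Convergence rates\<close>

text \<open>
  With \<open>x = (R\<^sup>2/\<rho>)\<^sup>2\<close> the alias sum is of the order of
  \<open>x\<^sup>M\<close>, of \<open>M\<close>, or bounded, according to whether \<open>x\<close>
  is greater than, equal to, or less than 1. In the first case \<open>R\<^bsup>-4M\<^esup>
  x\<^sup>M = \<rho>\<^bsup>-2M\<^esup>\<close>, so aliases and truncation contribute alike.
\<close>

lemma mfs_rate: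
  fixes k R \<rho> D :: real
  assumes "k > 0" "\<forall>m::int. bessel_J m k \<noteq> 0" "R > 1" "\<rho> > 1"
    and v: "continuous_on (sphere 0 1) v"
    and decay: "\<And>m. cmod (fourier_coeff v m) \<le> D / \<rho> ^ nat \<bar>m\<bar>"
  shows "\<exists>C>0. \<forall>N::nat. N > 0 \<and> even N \<longrightarrow>
        min_boundary_error k R v N \<le>
          (if \<rho> < R\<^sup>2 then C * \<rho> powr (- real N / 2)
           else if \<rho> = R\<^sup>2 then C * sqrt (real N) * R powr (- real N)
           else C * R powr (- real N))"
proof -
  obtain K where K: "K > 0" and bound: "\<And>M. M > 0 \<Longrightarrow> (min_boundary_error k R v (2 * M))\<^sup>2 \<le>
       2 * pi * D\<^sup>2 * (4 / (1 - (1 / \<rho>)\<^sup>2) * ((1 / \<rho>)\<^sup>2) ^ M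
         + K * (1 / R) ^ (2 * (2 * M)) * (\<Sum>n\<le>M. ((R\<^sup>2 / \<rho>)\<^sup>2) ^ n))"
    using mfs_error_bound[OF assms(1-3)] assms(4) v decay by blast
  define L where "L = 4 / (1 - (1 / \<rho>)\<^sup>2)"
  define p where "p = (1 / \<rho>)\<^sup>2"
  \<comment> \<open>Truncation decays like \<open>p\<^sup>M\<close> and a single alias block like \<open>Q\<^sup>M\<close>; the identity \<open>p = x Q\<close> links the two.\<close>
  define x where "x = (R\<^sup>2 / \<rho>)\<^sup>2"
  define Q where "Q = (1 / R) ^ 4"
  have p: "0 < p" "p < 1" using assms(4) by (simp_all add: p_def abs_square_less_1)
  have L: "L > 0" using p by (simp add: L_def p_def)
  have Q: "Q > 0" and x: "x > 0" using assms(3,4) by (simp_all add: Q_def x_def)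
  have pxQ: "p = x * Q"
    using assms(3,4) by (simp add: p_def x_def Q_def power_divide power_mult[symmetric] field_simps)
  have bound': "(min_boundary_error k R v (2 * M))\<^sup>2 \<le> 2 * pi * D\<^sup>2 * (L * p ^ M + K * Q ^ M * (\<Sum>n\<le>M. x ^ n))"
    if "M > 0" for M
  proof -
    have "(1 / R) ^ (2 * (2 * M)) = Q ^ M" unfolding Q_def by (simp add: power_mult[symmetric])
    with bound[OF that] show ?thesis unfolding L_def p_def x_def by simp
  qed
  \<comment> \<open>Each case is a bound on the square by a constant times the square of the claimed rate.\<close>
  have finish: "\<exists>C>0. \<forall>N::nat. N > 0 \<and> even N \<longrightarrow> min_boundary_error k R v N \<le> C * rate N"
    if E: "E \<ge> 0" and nonneg: "\<And>N. rate N \<ge> 0"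
      and sq: "\<And>M. M > 0 \<Longrightarrow> L * p ^ M + K * Q ^ M * (\<Sum>n\<le>M. x ^ n) \<le> E * (rate (2 * M))\<^sup>2"
    for E and rate :: "nat \<Rightarrow> real"
  proof (intro exI conjI allI impI)
    define C where "C = sqrt (2 * pi * D\<^sup>2 * E) + 1"
    have C2: "2 * pi * D\<^sup>2 * E \<le> C\<^sup>2"
    proof -
      have "(sqrt (2 * pi * D\<^sup>2 * E))\<^sup>2 \<le> C\<^sup>2" unfolding C_def using E by (intro power_mono) auto
      then show ?thesis using E by simp
    qed
    show C: "C > 0" unfolding C_def using E by (intro add_nonneg_pos) auto
    fix N :: nat assume "N > 0 \<and> even N"
    then obtain M where M: "N = 2 * M" "M > 0" by (auto elim: evenE)
    have "(min_boundary_error k R v N)\<^sup>2 \<le> 2 * pi * D\<^sup>2 * (L * p ^ M + K * Q ^ M * (\<Sum>n\<le>M. x ^ n))"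
      using bound'[OF M(2)] M(1) by simp
    also have "\<dots> \<le> 2 * pi * D\<^sup>2 * (E * (rate N)\<^sup>2)"
      unfolding M(1) by (intro mult_left_mono sq M) auto
    also have "\<dots> = (2 * pi * D\<^sup>2 * E) * (rate N)\<^sup>2" by simp
    also have "\<dots> \<le> C\<^sup>2 * (rate N)\<^sup>2" using C2 by (intro mult_right_mono) auto
    also have "\<dots> = (C * rate N)\<^sup>2" by (simp add: power_mult_distrib)
    finally show "min_boundary_error k R v N \<le> C * rate N"
      by (rule power2_le_imp_le) (use C nonneg in auto)
  qed
  have rateR: "(R powr (- real (2 * M)))\<^sup>2 = Q ^ M" for M
  proof -
    have "(R powr (- real (2 * M)))\<^sup>2 = ((1 / R) ^ (2 * M))\<^sup>2"
      using assms(3) by (simp add: powr_minus powr_realpow inverse_eq_divide power_divide del: of_nat_mult)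
    then show ?thesis by (simp add: Q_def power_mult[symmetric])
  qed
  have rate\<rho>: "(\<rho> powr (- real (2 * M) / 2))\<^sup>2 = p ^ M" for M
  proof -
    have "\<rho> powr (- real (2 * M) / 2) = (1 / \<rho>) ^ M"
      using assms(4) by (simp add: powr_minus powr_realpow inverse_eq_divide power_divide)
    then show ?thesis by (simp add: p_def power_mult[symmetric] mult.commute)
  qed
  consider "\<rho> < R\<^sup>2" | "\<rho> = R\<^sup>2" | "\<rho> > R\<^sup>2" by linarith
  then show ?thesis
  proof cases
    case 1
    then have "1 < R\<^sup>2 / \<rho>" using assms(4) by simp
    then have x1: "x > 1" unfolding x_def by (rule one_less_power) simp
    have "\<exists>C>0. \<forall>N::nat. N > 0 \<and> even N \<longrightarrow> min_boundary_error k R v N \<le> C * \<rho> powr (- real N / 2)"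
    proof (rule finish)
      show "L + K * (x / (x - 1)) \<ge> 0" using L K x1 by simp
      fix M :: nat
      have "(\<Sum>n\<le>M. x ^ n) \<le> x ^ M * (x / (x - 1))"
        using x1 sum_gp_basic[of x M] by (simp add: field_simps)
      then have "K * Q ^ M * (\<Sum>n\<le>M. x ^ n) \<le> K * Q ^ M * (x ^ M * (x / (x - 1)))"
        using K Q by (intro mult_left_mono) auto
      also have "\<dots> = K * (x / (x - 1)) * p ^ M"
        unfolding pxQ power_mult_distrib by simp
      finally show "L * p ^ M + K * Q ^ M * (\<Sum>n\<le>M. x ^ n)
          \<le> (L + K * (x / (x - 1))) * (\<rho> powr (- real (2 * M) / 2))\<^sup>2"
        unfolding rate\<rho> by (simp add: distrib_right)
    qed simp
    with 1 show ?thesis by simp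
  next
    case 2
    then have x1: "x = 1" using assms(3) by (simp add: x_def)
    have "\<exists>C>0. \<forall>N::nat. N > 0 \<and> even N \<longrightarrow> min_boundary_error k R v N \<le> C * (sqrt (real N) * R powr (- real N))"
    proof (rule finish)
      show "L + K \<ge> 0" using L K by simp
      show "0 \<le> sqrt (real N) * R powr (- real N)" for N by simp
      fix M :: nat assume M: "M > 0"
      have "L * Q ^ M * 1 \<le> L * Q ^ M * real (2 * M)" using L Q M by (intro mult_left_mono) auto
      moreover have "K * Q ^ M * (real M + 1) \<le> K * Q ^ M * real (2 * M)" using K Q M by (intro mult_left_mono) auto
      ultimately show "L * p ^ M + K * Q ^ M * (\<Sum>n\<le>M. x ^ n)
          \<le> (L + K) * (sqrt (real (2 * M)) * R powr (- real (2 * M)))\<^sup>2"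
        unfolding power_mult_distrib rateR by (simp add: x1 pxQ algebra_simps)
    qed
    with 2 show ?thesis by (simp add: mult.assoc)
  next
    case 3
    then have "R\<^sup>2 / \<rho> < 1" "R\<^sup>2 / \<rho> \<ge> 0" using assms(4) by simp_all
    then have x1: "x < 1" unfolding x_def by (simp add: abs_square_less_1)
    have "\<exists>C>0. \<forall>N::nat. N > 0 \<and> even N \<longrightarrow> min_boundary_error k R v N \<le> C * R powr (- real N)"
    proof (rule finish)
      show "L + K * (1 / (1 - x)) \<ge> 0" using L K x1 by simp
      fix M :: nat
      have "(\<Sum>n\<le>M. x ^ n) \<le> x ^ 0 / (1 - x)" using x x1 by (intro geometric_tail_le) auto
      then have "K * Q ^ M * (\<Sum>n\<le>M. x ^ n) \<le> K * Q ^ M * (1 / (1 - x))"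
        using K Q by (intro mult_left_mono) auto
      moreover have "L * (x ^ M * Q ^ M) \<le> L * (1 * Q ^ M)"
        using L Q x x1 by (intro mult_left_mono mult_right_mono power_le_one) auto
      ultimately show "L * p ^ M + K * Q ^ M * (\<Sum>n\<le>M. x ^ n)
          \<le> (L + K * (1 / (1 - x))) * (R powr (- real (2 * M)))\<^sup>2"
        unfolding rateR pxQ power_mult_distrib by (simp add: algebra_simps)
    qed simp
    with 3 show ?thesis by auto
  qed
qed

text \<open>
  The asymptotic equivalence bounds all but finitely many coefficients; the exceptional ones are
  absorbed in the constant.
\<close>

lemma asymptotic_decay_bound:
  fixes V :: "int \<Rightarrow> real"
  assumes "\<rho> > 0" "C\<^sub>0 > 0" "\<And>m. V m \<ge> 0"
    and "V \<sim>[filtercomap abs at_top] (\<lambda>m. C\<^sub>0 * \<rho> powi (- \<bar>m\<bar>))"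
  shows "\<exists>D. \<forall>m. V m \<le> D / \<rho> ^ nat \<bar>m\<bar>"
proof -
  have powi: "\<rho> powi (- \<bar>m\<bar>) = 1 / \<rho> ^ nat \<bar>m\<bar>" for m
    using assms(1) by (simp add: power_int_def inverse_eq_divide power_divide)
  obtain c where c: "c > 0"
    and ev: "\<forall>\<^sub>F m in filtercomap abs at_top. norm (V m) \<le> c * norm (C\<^sub>0 * \<rho> powi (- \<bar>m\<bar>))"
    using landau_o.bigE[OF asymp_equiv_imp_bigo[OF assms(4)]] by blast
  then obtain n\<^sub>0 where n\<^sub>0: "\<And>m. \<bar>m\<bar> \<ge> n\<^sub>0 \<Longrightarrow> norm (V m) \<le> c * norm (C\<^sub>0 * \<rho> powi (- \<bar>m\<bar>))"
    unfolding eventually_filtercomap_at_top_linorder by blast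
  define S where "S = (\<Sum>m\<in>{-n\<^sub>0..n\<^sub>0}. V m * \<rho> ^ nat \<bar>m\<bar>)"
  have S: "S \<ge> 0" unfolding S_def using assms by (intro sum_nonneg) auto
  have "V m \<le> (c * C\<^sub>0 + S) / \<rho> ^ nat \<bar>m\<bar>" for m
  proof -
    have "V m * \<rho> ^ nat \<bar>m\<bar> \<le> c * C\<^sub>0 + S"
    proof (cases "\<bar>m\<bar> \<ge> n\<^sub>0")
      case True
      then have "V m \<le> c * (C\<^sub>0 * (1 / \<rho> ^ nat \<bar>m\<bar>))"
        using n\<^sub>0[OF True] assms(1,2) assms(3)[of m] unfolding powi by simp
      then have "V m * \<rho> ^ nat \<bar>m\<bar> \<le> c * C\<^sub>0" using assms(1) by (simp add: field_simps)
      then show ?thesis using S by simp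
    next
      case False
      then have "V m * \<rho> ^ nat \<bar>m\<bar> \<le> S"
        unfolding S_def using assms by (intro member_le_sum) auto
      then show ?thesis using c assms(2) by (simp add: add_increasing)
    qed
    then show ?thesis using assms(1) by (simp add: field_simps)
  qed
  then show ?thesis by blast
qed

lemma analytic_boundary_data_continuous:
  assumes "analytic_boundary_data v"
  shows "continuous_on (sphere 0 1) v"
proof -
  obtain f where f: "f analytic_on sphere 0 1" "\<forall>z\<in>sphere 0 1. f z = v z"
    using assms unfolding analytic_boundary_data_def by blast
  from f(1) have "continuous_on (sphere 0 1) f"
    by (intro holomorphic_on_imp_continuous_on analytic_imp_holomorphic)
  then show ?thesis by (rule continuous_on_eq) (use f(2) in blast)
qed

lemma entire_boundary_data_continuous:
  assumes "entire_boundary_data v"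
  shows "continuous_on (sphere 0 1) v"
proof -
  obtain f where f: "f holomorphic_on UNIV" "\<forall>z\<in>sphere 0 1. f z = v z"
    using assms unfolding entire_boundary_data_def by blast
  from f(1) have "continuous_on (sphere 0 1) f"
    using holomorphic_on_imp_continuous_on continuous_on_subset by blast
  then show ?thesis by (rule continuous_on_eq) (use f(2) in blast)
qed

text \<open>
  The Fourier coefficients are the Taylor coefficients at the origin, whose series converges
  absolutely at radius \<open>\<rho>\<close>.
\<close>

lemma entire_boundary_data_decay:
  assumes "entire_boundary_data v" "\<rho> > 1"
  shows "\<exists>D. \<forall>m. cmod (fourier_coeff v m) \<le> D / \<rho> ^ nat \<bar>m\<bar>"
proof -
  obtain f where f: "f holomorphic_on UNIV" "\<forall>z\<in>sphere 0 1. f z = v z"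
    using assms(1) unfolding entire_boundary_data_def by blast
  define a where "a = (\<lambda>n. (deriv ^^ n) f 0 / fact n)"
  have series: "(\<lambda>n. a n * z ^ n) sums f z" for z
    using holomorphic_power_series[of f 0 "norm z + 1" z] holomorphic_on_subset[OF f(1)]
    by (simp add: a_def)
  have abs: "summable (\<lambda>n. norm (a n * z ^ n))" for z
  proof (rule powser_insidea[OF sums_summable[OF series[of "of_real (norm z + 1)"]]])
    show "norm z < norm (of_real (norm z + 1) :: complex)" unfolding norm_of_real by simp
  qed
  have coeff: "fourier_coeff v m = (if m \<ge> 0 then a (nat m) else 0)" for m
  proof (rule fourier_coeff_power_series)
    show "summable (\<lambda>n. norm (a n))" using abs[of 1] by simp
    show "(\<lambda>n. a n * z ^ n) sums v z" if "z \<in> sphere 0 1" for z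
      using series[of z] f(2) that by simp
  qed
  define D where "D = (\<Sum>n. norm (a n * of_real \<rho> ^ n))"
  have D: "norm (a n) * \<rho> ^ n \<le> D" for n
    using sum_le_suminf[OF abs[of "of_real \<rho>"], of "{n}"] assms(2)
    by (simp add: D_def norm_mult norm_power)
  have "norm (a 0) \<le> D" using D[of 0] by simp
  then have "D \<ge> 0" by (rule order_trans[OF norm_ge_zero])
  have "cmod (fourier_coeff v m) \<le> D / \<rho> ^ nat \<bar>m\<bar>" for m
    using D[of "nat m"] \<open>D \<ge> 0\<close> assms(2) by (simp add: coeff field_simps)
  then show ?thesis by blast
qed

theorem theorem3:
  fixes k R :: real
  assumes "k > 0"
    and "\<forall>m::int. bessel_J m k \<noteq> 0"
    and "R > 1"
  shows "(\<forall>(\<rho>::real) (C\<^sub>0::real) (v::complex \<Rightarrow> complex).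
      \<rho> > 1 \<and> C\<^sub>0 > 0 \<and> analytic_boundary_data v \<and>
      (\<lambda>m::int. cmod (fourier_coeff v m)) \<sim>[filtercomap abs at_top] (\<lambda>m. C\<^sub>0 * \<rho> powi (- \<bar>m\<bar>)) \<longrightarrow>
      (\<exists>C>0. \<forall>N::nat. N > 0 \<and> even N \<longrightarrow>
        min_boundary_error k R v N \<le>
          (if \<rho> < R\<^sup>2 then C * \<rho> powr (- real N / 2)
           else if \<rho> = R\<^sup>2 then C * sqrt (real N) * R powr (- real N)
           else C * R powr (- real N))))
    \<and> (\<forall>v::complex \<Rightarrow> complex. entire_boundary_data v \<longrightarrow>
      (\<exists>C>0. \<forall>N::nat. N > 0 \<and> even N \<longrightarrow>
        min_boundary_error k R v N \<le> C * R powr (- real N)))"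
proof (intro conjI allI impI)
  fix \<rho> C\<^sub>0 :: real and v :: "complex \<Rightarrow> complex"
  assume asm: "\<rho> > 1 \<and> C\<^sub>0 > 0 \<and> analytic_boundary_data v \<and>
      (\<lambda>m::int. cmod (fourier_coeff v m)) \<sim>[filtercomap abs at_top] (\<lambda>m. C\<^sub>0 * \<rho> powi (- \<bar>m\<bar>))"
  then obtain D where "\<And>m. cmod (fourier_coeff v m) \<le> D / \<rho> ^ nat \<bar>m\<bar>"
    using asymptotic_decay_bound[of \<rho> C\<^sub>0 "\<lambda>m. cmod (fourier_coeff v m)"] by auto
  with asm show "\<exists>C>0. \<forall>N::nat. N > 0 \<and> even N \<longrightarrow>
        min_boundary_error k R v N \<le>
          (if \<rho> < R\<^sup>2 then C * \<rho> powr (- real N / 2)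
           else if \<rho> = R\<^sup>2 then C * sqrt (real N) * R powr (- real N)
           else C * R powr (- real N))"
    using mfs_rate[OF assms] analytic_boundary_data_continuous by blast
next
  fix v :: "complex \<Rightarrow> complex"
  assume v: "entire_boundary_data v"
  \<comment> \<open>Any decay rate above \<open>R\<^sup>2\<close> leads to the third case of \<open>mfs_rate\<close>.\<close>
  define \<rho> where "\<rho> = R\<^sup>2 + 1"
  have \<rho>: "\<rho> > 1" "\<not> \<rho> < R\<^sup>2" "\<rho> \<noteq> R\<^sup>2" using assms(3) by (auto simp: \<rho>_def)
  obtain D where "\<And>m. cmod (fourier_coeff v m) \<le> D / \<rho> ^ nat \<bar>m\<bar>"
    using entire_boundary_data_decay[OF v \<rho>(1)] by blast
  from mfs_rate[OF assms \<rho>(1) entire_boundary_data_continuous[OF v] this]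
  show "\<exists>C>0. \<forall>N::nat. N > 0 \<and> even N \<longrightarrow> min_boundary_error k R v N \<le> C * R powr (- real N)"
    using \<rho>(2,3) by simp
qed

end
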